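(* Consider a distributed storage system (DSS) that uses an $[n,k]$ Reed-Solomon (RS) code $\mathscr{C}$ over $\mathbb{F}_q$ to store $f$ messages over $n$ noncolluding databases using systematic Lagrange encoding. Let $\mu\in\{f,f+1,\ldots,\mu_g(f)\}$ be the number of candidate polynomial function evaluations of degree at most $g$, including the $f$ independent messages. Let $\tilde k=\min\{g(k-1)+1,n\}$, $$\hat n=\begin{cases}n&\text{if }\lfloor n/\tilde k\rfloor=1\text{ and }n-\lfloor n/\tilde k\rfloor\tilde k<k,\\k+(\lfloor n/\tilde k\rfloor-1)\tilde k&\text{if }\lfloor n/\tilde k\rfloor>1\text{ and }n-\lfloor n/\tilde k\rfloor\tilde k<k,\\k+\lfloor n/\tilde k\rfloor\tilde k&\text{if }\lfloor n/\tilde k\rfloor\ge1\text{ and }n-\lfloor n/\tilde k\rfloor\tilde k\ge k,\end{cases}$$ and $\frac{\kappa}{\nu}=\frac{k}{\hat n-\lfloor\hat n/\tilde k\rfloor(\tilde k-k)}$. Then the private polynomial computation (PPC) rate $$\mathsf{R}^{\mathrm{S}}_{\mathrm{PPC}}=\begin{cases}\dfrac1f\,\mathsf{H}_{\min}&\text{if }n\le g(k-1)+1,\\[2ex]\dfrac{\frac{k}{\hat n}\left(\frac{\nu-\kappa}{\kappa}\right)\mathsf{H}_{\min}}{1-\left(\frac{\kappa}{\nu}\right)^{\min\{\mu,\mathsf{M}_g(f)\}}-\left(\min\{\mu,\mathsf{M}_g(f)\}-f\right)\left(1-\frac{\kappa}{\nu}\right)\left(\frac{\kappa}{\nu}\right)^{\mu-1}}&\text{otherwise}\end{cases}$$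 is achievable.
   Context: Notation: $[a]=\{1,\ldots,a\}$; entropies $H$ are in $q$-ary units. $\mathsf{M}_g(f)=\binom{g+f}{g}-1$ is the number of monomials in $f$ variables of degree between $1$ and $g$, and $\mu_g(f)=\frac{q^{\mathsf{M}_g(f)}-1}{q-1}$ is the number of polynomials that are linear combinations over $\mathbb{F}_q$ of these monomials with nonzero coefficient vectors, counted up to scalar multiples. Systematic Lagrange encoding: let $\alpha_1,\ldots,\alpha_n\in\mathbb{F}_q$ be distinct ($q\ge n\ge k$). The $[n,k]$ RS code is $\{(\phi(\alpha_1),\ldots,\phi(\alpha_n)):\phi\in\mathbb{F}_q[z],\deg\phi<k\}$; a vector $(w_1,\ldots,w_k)\in\mathbb{F}_q^k$ is encoded as $(\ell(\alpha_1),\ldots,\ell(\alpha_n))$, where $\ell$ is the unique polynomial of degree at most $k-1$ with $\ell(\alpha_i)=w_i$ for all $i\in[k]$ (so the first $k$ code symbols are the information symbols). Storage: there are $f$ independent messages $\mathbf{W}^{(1)},\ldots,\mathbf{W}^{(f)}$; each $\mathbf{W}^{(m)}$ is a random $\beta\times k$ matrix with entries i.i.d. uniform over $\mathbb{F}_q$, also written as a vector $(W^{(m)}_1,\ldots,W^{(m)}_{\mathsf{L}})$ with $\mathsf{L}=\beta k$. Each row $\mathbf{W}^{(m)}_i$ is encoded into $(C^{(m)}_{i,1},\ldots,C^{(m)}_{i,n})$. Database $j\in[n]$ stores $\mathbf{C}_j=(C^{(m)}_{i,j})_{i\in[\beta],m\in[f]}$. The parameter $\beta$ may be chosen by the scheme.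 Candidate functions: $\phi^{(1)},\ldots,\phi^{(\mu)}$ are polynomials in $f$ variables over $\mathbb{F}_q$ that are linear combinations of monomials of degree between $1$ and $g$ with pairwise nonproportional nonzero coefficient vectors, and the coordinate polynomials $z_1,\ldots,z_f$ (the $f$ messages) are among them. Put $X^{(v)}_l=\phi^{(v)}(W^{(1)}_l,\ldots,W^{(f)}_l)$ for $l\in[\mathsf{L}]$, $\mathbf{X}^{(v)}=(X^{(v)}_1,\ldots,X^{(v)}_{\mathsf{L}})$, $\mathbf{X}^{[\mu]}=(\mathbf{X}^{(1)},\ldots,\mathbf{X}^{(\mu)})$, and $\mathsf{H}_{\min}=\min_{v\in[\mu]}H(X^{(v)}_l)$ (independent of $l$). PPC protocol: for each desired index $v\in[\mu]$ the user sends a (random) query $Q^{(v)}_j$, generated independently of the messages, to each database $j\in[n]$ (possibly an empty query, in which case nothing is downloaded from it). Database $j$ returns an answer $A^{(v)}_j$ (a string of symbols of $\mathbb{F}_q$) that is a deterministic function of $Q^{(v)}_j$ and $\mathbf{C}_j$. The protocol must satisfy, for all $v\ne v'$ in $[\mu]$ and $j\in[n]$: (privacy) $(Q^{(v)}_j,A^{(v)}_j,\mathbf{X}^{[\mu]})$ and $(Q^{(v')}_j,A^{(v')}_j,\mathbf{X}^{[\mu]})$ are identically distributed; (recovery) $H(\mathbf{X}^{(v)}\mid A^{(v)}_1,\ldots,A^{(v)}_n,Q^{(v)}_1,\ldots,Q^{(v)}_n)=0$. Rate: the rate of a protocol is $\mathsf{L}\mathsf{H}_{\min}/\mathsf{D}$,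 where $\mathsf{D}$ is the total download cost, i.e. the total number of symbols of $\mathbb{F}_q$ downloaded from all databases. A rate is achievable if there is a PPC protocol attaining it for some $\beta$. *)

theory Defs
  imports
    "HOL-Probability.Probability"
    "HOL-Library.Poly_Mapping"
    "HOL-Computational_Algebra.Polynomial"
begin

text \<open>
  The field \<open>\<bbbF>\<^sub>q\<close> is a type \<open>'a :: {finite, field}\<close> with \<open>q = CARD('a)\<close>.
  All index sets start at 1, as in \<open>[a] = {1, \<dots>, a}\<close>.
\<close>

subsection \<open>Multivariate polynomials and candidate functions\<close>

type_synonym 'a mpoly = "(nat \<Rightarrow>\<^sub>0 nat) \<Rightarrow>\<^sub>0 'a"

definition monom_deg :: "(nat \<Rightarrow>\<^sub>0 nat) \<Rightarrow> nat" where
  "monom_deg t = (\<Sum>m\<in>Poly_Mapping.keys t. Poly_Mapping.lookup t m)"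

definition monoms :: "nat \<Rightarrow> nat \<Rightarrow> (nat \<Rightarrow>\<^sub>0 nat) set" where
  "monoms g f = {t. Poly_Mapping.keys t \<subseteq> {1..f} \<and> 1 \<le> monom_deg t \<and> monom_deg t \<le> g}"

definition eval_mpoly :: "'a::comm_semiring_1 mpoly \<Rightarrow> (nat \<Rightarrow> 'a) \<Rightarrow> 'a" where
  "eval_mpoly p x = (\<Sum>t\<in>Poly_Mapping.keys p.
     Poly_Mapping.lookup p t * (\<Prod>m\<in>Poly_Mapping.keys t. x m ^ Poly_Mapping.lookup t m))"

definition var_mpoly :: "nat \<Rightarrow> 'a::comm_semiring_1 mpoly" where
  "var_mpoly m = Poly_Mapping.single (Poly_Mapping.single m 1) 1"

definition num_monoms :: "nat \<Rightarrow> nat \<Rightarrow> nat" where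
  "num_monoms g f = ((g + f) choose g) - 1"

text \<open>The division is exact, since \<open>q - 1\<close> divides \<open>q ^ M - 1\<close>.\<close>

definition num_candidates :: "nat \<Rightarrow> nat \<Rightarrow> nat \<Rightarrow> nat" where
  "num_candidates q g f = (q ^ num_monoms g f - 1) div (q - 1)"

definition candidate_family :: "nat \<Rightarrow> nat \<Rightarrow> nat \<Rightarrow> (nat \<Rightarrow> 'a::field mpoly) \<Rightarrow> bool" where
  "candidate_family g f \<mu> \<phi> \<longleftrightarrow>
     (\<forall>v\<in>{1..\<mu>}. Poly_Mapping.keys (\<phi> v) \<subseteq> monoms g f \<and> \<phi> v \<noteq> 0) \<and>
     (\<forall>v\<in>{1..\<mu>}. \<forall>v'\<in>{1..\<mu>}. v \<noteq> v' \<longrightarrow>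
        \<not> (\<exists>c. \<forall>t. Poly_Mapping.lookup (\<phi> v) t = c * Poly_Mapping.lookup (\<phi> v') t)) \<and>
     (\<forall>m\<in>{1..f}. \<exists>v\<in>{1..\<mu>}. \<phi> v = var_mpoly m)"


subsection \<open>Entropy of discrete random variables\<close>

definition discrete_entropy :: "real \<Rightarrow> 'w pmf \<Rightarrow> ('w \<Rightarrow> 'x) \<Rightarrow> real" where
  "discrete_entropy b p X = prob_space.entropy (measure_pmf p) b (count_space (range X)) X"

definition discrete_cond_entropy ::
    "real \<Rightarrow> 'w pmf \<Rightarrow> ('w \<Rightarrow> 'x) \<Rightarrow> ('w \<Rightarrow> 'y) \<Rightarrow> real" where
  "discrete_cond_entropy b p X Y =
     prob_space.conditional_entropy (measure_pmf p) b
       (count_space (range X)) (count_space (range Y)) X Y"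


subsection \<open>Messages, function evaluations and storage\<close>

text \<open>
  An outcome \<open>w\<close> of the messages assigns to \<open>(m, i, c)\<close> the entry in row \<open>i\<close> and
  column \<open>c\<close> of the \<open>\<beta> \<times> k\<close> matrix \<open>W\<^sup>(\<^sup>m\<^sup>)\<close>.
\<close>

type_synonym 'a messages = "nat \<times> nat \<times> nat \<Rightarrow> 'a"

definition message_pmf :: "nat \<Rightarrow> nat \<Rightarrow> nat \<Rightarrow> 'a::{finite, field} messages pmf" where
  "message_pmf f \<beta> k = Pi_pmf ({1..f} \<times> {1..\<beta>} \<times> {1..k}) 0 (\<lambda>_. pmf_of_set UNIV)"

text \<open>Vector form of a message matrix, read row by row: \<open>l = (i - 1) k + c\<close>.\<close>

definition message_symbol :: "nat \<Rightarrow> 'a messages \<Rightarrow> nat \<Rightarrow> nat \<Rightarrow> 'a" where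
  "message_symbol k w l m = w (m, (l - 1) div k + 1, (l - 1) mod k + 1)"

definition fun_symbol ::
    "(nat \<Rightarrow> 'a::comm_semiring_1 mpoly) \<Rightarrow> nat \<Rightarrow> nat \<Rightarrow> nat \<Rightarrow> 'a messages \<Rightarrow> 'a" where
  "fun_symbol \<phi> k v l w = eval_mpoly (\<phi> v) (message_symbol k w l)"

definition fun_vector ::
    "(nat \<Rightarrow> 'a::comm_semiring_1 mpoly) \<Rightarrow> nat \<Rightarrow> nat \<Rightarrow> nat \<Rightarrow> 'a messages \<Rightarrow> 'a list" where
  "fun_vector \<phi> k \<beta> v w = map (\<lambda>l. fun_symbol \<phi> k v l w) [1..<\<beta> * k + 1]"

definition fun_vectors ::
    "(nat \<Rightarrow> 'a::comm_semiring_1 mpoly) \<Rightarrow> nat \<Rightarrow> nat \<Rightarrow> nat \<Rightarrow> 'a messages \<Rightarrow> 'a list list" where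
  "fun_vectors \<phi> \<mu> k \<beta> w = map (\<lambda>v. fun_vector \<phi> k \<beta> v w) [1..<\<mu> + 1]"

text \<open>
  The law of \<open>(W\<^sup>(\<^sup>1\<^sup>)\<^sub>l, \<dots>, W\<^sup>(\<^sup>f\<^sup>)\<^sub>l)\<close> is the same for all \<open>\<beta>\<close> and all \<open>l\<close>, so the minimum entropy
  is defined from that law; see lemma \<open>H_min_eq\<close> below.
\<close>

definition symbol_pmf :: "nat \<Rightarrow> (nat \<Rightarrow> 'a::{finite, field}) pmf" where
  "symbol_pmf f = Pi_pmf {1..f} 0 (\<lambda>_. pmf_of_set UNIV)"

definition H_min :: "nat \<Rightarrow> nat \<Rightarrow> (nat \<Rightarrow> 'a::{finite, field} mpoly) \<Rightarrow> real" where
  "H_min f \<mu> \<phi> = Min ((\<lambda>v. discrete_entropy (real CARD('a)) (symbol_pmf f) (eval_mpoly (\<phi> v))) ` {1..\<mu>})"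

definition lagrange_poly :: "(nat \<Rightarrow> 'a::field) \<Rightarrow> nat \<Rightarrow> (nat \<Rightarrow> 'a) \<Rightarrow> 'a poly" where
  "lagrange_poly \<alpha> k u = (THE p. degree p \<le> k - 1 \<and> (\<forall>i\<in>{1..k}. poly p (\<alpha> i) = u i))"

definition code_symbol :: "(nat \<Rightarrow> 'a::field) \<Rightarrow> nat \<Rightarrow> 'a messages \<Rightarrow> nat \<Rightarrow> nat \<Rightarrow> nat \<Rightarrow> 'a" where
  "code_symbol \<alpha> k w m i j = poly (lagrange_poly \<alpha> k (\<lambda>c. w (m, i, c))) (\<alpha> j)"

definition stored ::
    "(nat \<Rightarrow> 'a::field) \<Rightarrow> nat \<Rightarrow> nat \<Rightarrow> nat \<Rightarrow> nat \<Rightarrow> 'a messages \<Rightarrow> (nat \<times> nat \<Rightarrow> 'a)" where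
  "stored \<alpha> k f \<beta> j w = (\<lambda>(i, m)\<in>{1..\<beta>} \<times> {1..f}. code_symbol \<alpha> k w m i j)"


subsection \<open>Private polynomial computation\<close>

text \<open>
  The user draws a random key, independently of the messages; the query to database \<open>j\<close> for
  the desired index \<open>v\<close> is a function of the key. Queries are encoded by natural numbers,
  and \<open>None\<close> is the empty query, to which nothing is returned. The answer function of a
  database has no access to \<open>v\<close>.
\<close>

record 'a ppc_protocol =
  key_pmf :: "nat pmf"
  query :: "nat \<Rightarrow> nat \<Rightarrow> nat \<Rightarrow> nat option"
  respond :: "nat \<Rightarrow> nat \<Rightarrow> (nat \<times> nat \<Rightarrow> 'a) \<Rightarrow> 'a list"

definition joint_pmf ::
    "nat \<Rightarrow> nat \<Rightarrow> nat \<Rightarrow> 'a::{finite, field} ppc_protocol \<Rightarrow> ('a messages \<times> nat) pmf" where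
  "joint_pmf f \<beta> k prot = pair_pmf (message_pmf f \<beta> k) (key_pmf prot)"

definition query_rv :: "'a ppc_protocol \<Rightarrow> nat \<Rightarrow> nat \<Rightarrow> 'a messages \<times> nat \<Rightarrow> nat option" where
  "query_rv prot v j = (\<lambda>(w, s). query prot v j s)"

definition answer_rv ::
    "(nat \<Rightarrow> 'a::field) \<Rightarrow> nat \<Rightarrow> nat \<Rightarrow> nat \<Rightarrow> 'a ppc_protocol \<Rightarrow> nat \<Rightarrow> nat \<Rightarrow>
     'a messages \<times> nat \<Rightarrow> 'a list" where
  "answer_rv \<alpha> k f \<beta> prot v j = (\<lambda>(w, s).
     case query prot v j s of None \<Rightarrow> [] | Some x \<Rightarrow> respond prot j x (stored \<alpha> k f \<beta> j w))"

definition ppc_private ::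
    "(nat \<Rightarrow> 'a::{finite, field}) \<Rightarrow> nat \<Rightarrow> nat \<Rightarrow> nat \<Rightarrow> nat \<Rightarrow> (nat \<Rightarrow> 'a mpoly) \<Rightarrow>
     nat \<Rightarrow> 'a ppc_protocol \<Rightarrow> bool" where
  "ppc_private \<alpha> n k f \<mu> \<phi> \<beta> prot \<longleftrightarrow>
     (\<forall>v\<in>{1..\<mu>}. \<forall>v'\<in>{1..\<mu>}. \<forall>j\<in>{1..n}. v \<noteq> v' \<longrightarrow>
        map_pmf (\<lambda>\<omega>. (query_rv prot v j \<omega>, answer_rv \<alpha> k f \<beta> prot v j \<omega>, fun_vectors \<phi> \<mu> k \<beta> (fst \<omega>)))
          (joint_pmf f \<beta> k prot) =
        map_pmf (\<lambda>\<omega>. (query_rv prot v' j \<omega>, answer_rv \<alpha> k f \<beta> prot v' j \<omega>, fun_vectors \<phi> \<mu> k \<beta> (fst \<omega>)))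
          (joint_pmf f \<beta> k prot))"

definition ppc_recovers ::
    "(nat \<Rightarrow> 'a::{finite, field}) \<Rightarrow> nat \<Rightarrow> nat \<Rightarrow> nat \<Rightarrow> nat \<Rightarrow> (nat \<Rightarrow> 'a mpoly) \<Rightarrow>
     nat \<Rightarrow> 'a ppc_protocol \<Rightarrow> bool" where
  "ppc_recovers \<alpha> n k f \<mu> \<phi> \<beta> prot \<longleftrightarrow>
     (\<forall>v\<in>{1..\<mu>}. discrete_cond_entropy (real CARD('a)) (joint_pmf f \<beta> k prot)
        (\<lambda>\<omega>. fun_vector \<phi> k \<beta> v (fst \<omega>))
        (\<lambda>\<omega>. (map (\<lambda>j. answer_rv \<alpha> k f \<beta> prot v j \<omega>) [1..<n + 1],
              map (\<lambda>j. query_rv prot v j \<omega>) [1..<n + 1])) = 0)"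

text \<open>
  The download cost \<open>D\<close> is a fixed number: for every desired index and every outcome of positive
  probability, the answers together consist of exactly \<open>D\<close> symbols.
\<close>

definition ppc_downloads ::
    "(nat \<Rightarrow> 'a::{finite, field}) \<Rightarrow> nat \<Rightarrow> nat \<Rightarrow> nat \<Rightarrow> nat \<Rightarrow> nat \<Rightarrow> 'a ppc_protocol \<Rightarrow> nat \<Rightarrow> bool" where
  "ppc_downloads \<alpha> n k f \<mu> \<beta> prot D \<longleftrightarrow>
     (\<forall>v\<in>{1..\<mu>}. \<forall>\<omega>\<in>set_pmf (joint_pmf f \<beta> k prot).
        (\<Sum>j=1..n. length (answer_rv \<alpha> k f \<beta> prot v j \<omega>)) = D)"

definition ppc_achievable ::
    "(nat \<Rightarrow> 'a::{finite, field}) \<Rightarrow> nat \<Rightarrow> nat \<Rightarrow> nat \<Rightarrow> nat \<Rightarrow> (nat \<Rightarrow> 'a mpoly) \<Rightarrow> real \<Rightarrow> bool" where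
  "ppc_achievable \<alpha> n k f \<mu> \<phi> R \<longleftrightarrow>
     (\<exists>\<beta> prot D. 1 \<le> \<beta> \<and> 0 < D \<and>
        ppc_private \<alpha> n k f \<mu> \<phi> \<beta> prot \<and>
        ppc_recovers \<alpha> n k f \<mu> \<phi> \<beta> prot \<and>
        ppc_downloads \<alpha> n k f \<mu> \<beta> prot D \<and>
        R = real (\<beta> * k) * H_min f \<mu> \<phi> / real D)"


subsection \<open>Parameters of the rate\<close>

definition k_tilde :: "nat \<Rightarrow> nat \<Rightarrow> nat \<Rightarrow> nat" where
  "k_tilde g k n = min (g * (k - 1) + 1) n"

text \<open>
  Since \<open>1 \<le> k_tilde g k n \<le> n\<close> for \<open>n \<ge> 1\<close>, the quotient \<open>n div k_tilde g k n\<close> is at least 1 and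
  the last branch is the case of a remainder that is at least \<open>k\<close>.
\<close>

definition n_hat :: "nat \<Rightarrow> nat \<Rightarrow> nat \<Rightarrow> nat" where
  "n_hat g k n = (let k' = k_tilde g k n; s = n div k' in
     if s = 1 \<and> n - s * k' < k then n
     else if s > 1 \<and> n - s * k' < k then k + (s - 1) * k'
     else k + s * k')"


subsection \<open>Well-definedness\<close>

lemma lagrange_poly_unique:
  fixes \<alpha> :: "nat \<Rightarrow> 'a::field"
  assumes "inj_on \<alpha> {1..k}" and "1 \<le> k"
  shows "\<exists>!p. degree p \<le> k - 1 \<and> (\<forall>i\<in>{1..k}. poly p (\<alpha> i) = u i)"
proof (rule ex_ex1I)
  define b where "b i = (\<Prod>j\<in>{1..k} - {i}. [:- \<alpha> j, 1:])" for i
  define p where "p = (\<Sum>i\<in>{1..k}. smult (u i / poly (b i) (\<alpha> i)) (b i))"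
  have deg: "degree (b i) \<le> k - 1" if "i \<in> {1..k}" for i
  proof -
    have "degree (b i) \<le> sum (degree \<circ> (\<lambda>j. [:- \<alpha> j, 1:])) ({1..k} - {i})"
      unfolding b_def by (rule degree_prod_sum_le) simp
    also have "\<dots> = k - 1" using that by simp
    finally show ?thesis .
  qed
  have "degree p \<le> k - 1" unfolding p_def
    proof (rule degree_sum_le)
    fix i assume "i \<in> {1..k}"
    then show "degree (smult (u i / poly (b i) (\<alpha> i)) (b i)) \<le> k - 1"
      using deg[of i] degree_smult_le[of "u i / poly (b i) (\<alpha> i)" "b i"] by linarith
  qed simp
  moreover have "poly p (\<alpha> i) = u i" if i: "i \<in> {1..k}" for i
  proof -
    have z: "poly (b j) (\<alpha> i) = 0" if "j \<in> {1..k} - {i}" for j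
      using i that unfolding b_def poly_prod by (intro prod_zero) auto
    have nz: "poly (b i) (\<alpha> i) \<noteq> 0"
      using i assms(1) unfolding b_def poly_prod
      by (subst prod_zero_iff) (auto dest: inj_onD)
    have "poly p (\<alpha> i) = (\<Sum>j\<in>{1..k}. u j / poly (b j) (\<alpha> j) * poly (b j) (\<alpha> i))"
      by (simp add: p_def poly_sum)
    also have "\<dots> = (\<Sum>j\<in>{i}. u j / poly (b j) (\<alpha> j) * poly (b j) (\<alpha> i))"
      by (rule sum.mono_neutral_right) (use i z in auto)
    finally show ?thesis using nz by simp
  qed
  ultimately show "\<exists>p. degree p \<le> k - 1 \<and> (\<forall>i\<in>{1..k}. poly p (\<alpha> i) = u i)" by blast
next
  fix p r
  assume p: "degree p \<le> k - 1 \<and> (\<forall>i\<in>{1..k}. poly p (\<alpha> i) = u i)"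
    and r: "degree r \<le> k - 1 \<and> (\<forall>i\<in>{1..k}. poly r (\<alpha> i) = u i)"
  have c: "card (\<alpha> ` {1..k}) = k" using assms(1) by (simp add: card_image)
  show "p = r"
    by (rule poly_eqI_degree[of "\<alpha> ` {1..k}"]) (use p r c assms(2) in auto)
qed

lemma map_symbol_pmf:
  assumes "1 \<le> l" and "l \<le> \<beta> * k"
  shows "map_pmf (\<lambda>w m. if m \<in> {1..f} then message_symbol k w l m else 0) (message_pmf f \<beta> k)
       = (symbol_pmf f :: (nat \<Rightarrow> 'a::{finite, field}) pmf)"
proof -
  define i where "i = (l - 1) div k + 1"
  define c where "c = (l - 1) mod k + 1"
  define I where "I = {1..f} \<times> {1..\<beta>} \<times> {1..k}"
  define J where "J = {1..f} \<times> {i} \<times> {c}"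
  define h where "h = (\<lambda>m::nat. (m, i, c))"
  have "k > 0" using assms by (cases k) auto
  have "(l - 1) div k < \<beta>"
    using assms by (subst less_mult_imp_div_less) auto
  then have i: "i \<in> {1..\<beta>}" and c: "c \<in> {1..k}"
    using \<open>k > 0\<close> by (auto simp: i_def c_def Suc_le_eq)
  have sub: "J \<subseteq> I" using i c by (auto simp: I_def J_def)
  have J: "Pi_pmf J 0 (\<lambda>_. pmf_of_set UNIV) =
      map_pmf (\<lambda>w x. if x \<in> J then w x else 0) (message_pmf f \<beta> k :: 'a messages pmf)"
    unfolding message_pmf_def I_def[symmetric]
    by (rule Pi_pmf_subset) (use sub in \<open>auto simp: I_def\<close>)
  have "symbol_pmf f = map_pmf (\<lambda>w. w \<circ> h) (Pi_pmf J 0 (\<lambda>_. pmf_of_set (UNIV :: 'a set)))"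
    unfolding symbol_pmf_def
    by (rule Pi_pmf_bij_betw) (auto simp: bij_betw_def inj_on_def h_def J_def)
  also have "\<dots> = map_pmf (\<lambda>w m. if m \<in> {1..f} then message_symbol k w l m else 0) (message_pmf f \<beta> k)"
    unfolding J pmf.map_comp
    by (intro map_pmf_cong refl) (auto simp: fun_eq_iff h_def J_def message_symbol_def i_def c_def)
  finally show ?thesis ..
qed

lemma eval_mpoly_cong:
  assumes "Poly_Mapping.keys p \<subseteq> monoms g f" and "\<And>m. m \<in> {1..f} \<Longrightarrow> x m = y m"
  shows "eval_mpoly p x = eval_mpoly p y"
  unfolding eval_mpoly_def
proof (intro sum.cong prod.cong refl arg_cong2[where f = "(*)"] arg_cong2[where f = power])
  fix t m assume "t \<in> Poly_Mapping.keys p" "m \<in> Poly_Mapping.keys t"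
  then have "m \<in> {1..f}" using assms(1) unfolding monoms_def by blast
  then show "x m = y m" by (rule assms(2))
qed

lemma H_min_eq:
  fixes \<phi> :: "nat \<Rightarrow> 'a::{finite, field} mpoly"
  assumes "candidate_family g f \<mu> \<phi>" and "1 \<le> l" and "l \<le> \<beta> * k"
  shows "H_min f \<mu> \<phi> =
    Min ((\<lambda>v. discrete_entropy (real CARD('a)) (message_pmf f \<beta> k) (fun_symbol \<phi> k v l)) ` {1..\<mu>})"
proof -
  have "discrete_entropy b (symbol_pmf f) (eval_mpoly (\<phi> v))
      = discrete_entropy b (message_pmf f \<beta> k) (fun_symbol \<phi> k v l)" if v: "v \<in> {1..\<mu>}" for b v
  proof -
    define h where "h = (\<lambda>(w :: 'a messages) m. if m \<in> {1..f} then message_symbol k w l m else 0)"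
    have keys: "Poly_Mapping.keys (\<phi> v) \<subseteq> monoms g f"
      using assms(1) v by (auto simp: candidate_family_def)
    have eval: "eval_mpoly (\<phi> v) (h w) = fun_symbol \<phi> k v l w" for w
      unfolding fun_symbol_def by (rule eval_mpoly_cong[OF keys]) (simp add: h_def)
    have pmf: "(symbol_pmf f :: (nat \<Rightarrow> 'a) pmf) = map_pmf h (message_pmf f \<beta> k)"
      unfolding h_def by (rule map_symbol_pmf[OF assms(2,3), symmetric])
    have "eval_mpoly (\<phi> v) x \<in> range (fun_symbol \<phi> k v l)" for x
    proof (rule range_eqI)
      have "message_symbol k (\<lambda>(m, _, _). x m) l = x"
        by (rule ext) (simp add: message_symbol_def)
      then show "eval_mpoly (\<phi> v) x = fun_symbol \<phi> k v l (\<lambda>(m, _, _). x m)"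
        by (simp only: fun_symbol_def)
    qed
    then have range: "range (eval_mpoly (\<phi> v)) = range (fun_symbol \<phi> k v l)"
      by (auto simp: fun_symbol_def)
    have "distr (symbol_pmf f) N (eval_mpoly (\<phi> v)) = distr (message_pmf f \<beta> k) N (fun_symbol \<phi> k v l)"
      if N: "N = count_space (range (eval_mpoly (\<phi> v)))" for N
    proof (rule measure_eqI)
      fix A assume A: "A \<in> sets (distr (symbol_pmf f) N (eval_mpoly (\<phi> v)))"
      have m1: "eval_mpoly (\<phi> v) \<in> measurable (symbol_pmf f) N" by (simp add: N)
      have m2: "fun_symbol \<phi> k v l \<in> measurable (message_pmf f \<beta> k) N"
        by (simp add: N range)
      have "emeasure (distr (symbol_pmf f) N (eval_mpoly (\<phi> v))) A
          = emeasure (message_pmf f \<beta> k) (h -` (eval_mpoly (\<phi> v) -` A))"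
        using A by (subst emeasure_distr[OF m1]) (simp_all only: pmf emeasure_map_pmf sets_distr space_measure_pmf Int_UNIV_right)
      also have "h -` (eval_mpoly (\<phi> v) -` A) = fun_symbol \<phi> k v l -` A"
        using eval by (simp only: vimage_def mem_Collect_eq)
      also have "emeasure (message_pmf f \<beta> k) (fun_symbol \<phi> k v l -` A)
          = emeasure (distr (message_pmf f \<beta> k) N (fun_symbol \<phi> k v l)) A"
        using A by (subst emeasure_distr[OF m2]) (simp_all only: sets_distr space_measure_pmf Int_UNIV_right)
      finally show "emeasure (distr (symbol_pmf f) N (eval_mpoly (\<phi> v))) A
          = emeasure (distr (message_pmf f \<beta> k) N (fun_symbol \<phi> k v l)) A" .
    qed (simp only: sets_distr)
    from this[OF refl] show ?thesis
      by (simp only: discrete_entropy_def prob_space.entropy_def[OF prob_space_measure_pmf] range)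
  qed
  then show ?thesis
    unfolding H_min_def by (intro arg_cong[where f = Min] image_cong refl) auto
qed

end

theory Submission
  imports Defs
begin

text \<open>
  If \<open>n \<le> g (k - 1) + 1\<close>, all messages are downloaded from the systematic databases. Otherwise a
  Sun--Jafar scheme is run on the \<open>\<mu>\<close> candidates. Along a row of the storage a candidate is a
  polynomial of degree at most \<open>g (k - 1)\<close> in \<open>\<alpha>\<^sub>j\<close>, so its \<open>k\<close> systematic values can be read either from the \<open>k\<close>
  systematic databases or from any \<open>g (k - 1) + 1\<close> databases. Every database answers with sums
  \<open>\<Sum>i\<in>S. \<plusminus> X\<^sub>i(u\<^bsub>S - {i}\<^esub>)\<close> of randomly permuted and scaled rows \<open>u\<^sub>T\<close>, for \<open>S \<subseteq> {1..\<mu>}\<close>. If \<open>S\<close> contains the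
  desired index \<open>v\<close>, the sum is a desired symbol plus an interference that other databases return as
  their sum over \<open>S - {v}\<close>.

  The signs are those of the coproduct of the exterior algebra. Therefore linear dependencies between
  the candidates make all sums over \<open>S\<close> disjoint from a spanning set of \<open>min \<mu> (num_monoms g f)\<close>
  candidates redundant, which gives the term \<open>(\<kappa>/\<nu>) ^ min \<mu> (num_monoms g f)\<close> of the rate. The sums
  with \<open>card S = 1\<close> are evaluations of the candidates at the same \<open>f\<close> code symbols, and sending these
  symbols instead gives the other correction term.
\<close>

section \<open>Achievability from a combinatorial scheme\<close>

text \<open>If \<open>X\<close> is a function of \<open>Y\<close>, each joint atom has the
  probability of its \<open>Y\<close>-atom, so every term of the finite entropy sum has weight zero
  or the logarithm of 1.\<close>

lemma discrete_cond_entropy_eq_0: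
  fixes X :: "'w \<Rightarrow> 'x" and Y :: "'w \<Rightarrow> 'y"
  assumes "1 < b" and fin: "finite (range Y)" and X: "\<And>\<omega>. X \<omega> = h (Y \<omega>)"
  shows "discrete_cond_entropy b p X Y = 0"
proof -
  interpret information_space "measure_pmf p" b
    by unfold_locales (fact \<open>1 < b\<close>)
  have "range (\<lambda>\<omega>. (X \<omega>, Y \<omega>)) = (\<lambda>y. (h y, y)) ` range Y"
    by (simp add: X image_image)
  then have fin2: "finite (range (\<lambda>\<omega>. (X \<omega>, Y \<omega>)))"
    using fin by simp
  define Py where "Py y = measure p (Y -` {y})" for y
  define Pxy where "Pxy z = measure p ((\<lambda>\<omega>. (X \<omega>, Y \<omega>)) -` {z})" for z
  have Y: "simple_distributed p Y Py"
    by (rule measure_pmf.simple_distributedI) (auto simp: simple_function_def fin Py_def)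
  have XY: "simple_distributed p (\<lambda>\<omega>. (X \<omega>, Y \<omega>)) Pxy"
    by (rule measure_pmf.simple_distributedI) (auto simp: simple_function_def fin2 Pxy_def)
  have "discrete_cond_entropy b p X Y
      = - (\<Sum>(x, y)\<in>range (\<lambda>\<omega>. (X \<omega>, Y \<omega>)). Pxy (x, y) * log b (Pxy (x, y) / Py y))"
    using conditional_entropy_eq[OF Y XY] by (simp add: discrete_cond_entropy_def)
  also have "(\<Sum>(x, y)\<in>range (\<lambda>\<omega>. (X \<omega>, Y \<omega>)). Pxy (x, y) * log b (Pxy (x, y) / Py y)) = 0"
  proof (intro sum.neutral ballI)
    fix z assume "z \<in> range (\<lambda>\<omega>. (X \<omega>, Y \<omega>))"
    then obtain \<omega> where z: "z = (X \<omega>, Y \<omega>)" by blast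
    have "(\<lambda>\<omega>. (X \<omega>, Y \<omega>)) -` {z} = Y -` {Y \<omega>}"
      using X z by auto
    then have "Pxy z = Py (Y \<omega>)" by (simp add: Pxy_def Py_def)
    then show "(case z of (x, y) \<Rightarrow> Pxy (x, y) * log b (Pxy (x, y) / Py y)) = 0"
      unfolding z by (cases "Py (Y \<omega>) = 0") auto
  qed
  finally show ?thesis by simp
qed

text \<open>Encoding acts row by row, so a block of rows is stored like messages of its own.\<close>

lemma stored_block:
  assumes "b < t"
  shows "stored \<alpha> k f \<beta> j (\<lambda>(m, i, c). w (m, b * \<beta> + i, c)) =
    (\<lambda>(i, m)\<in>{1..\<beta>} \<times> {1..f}. stored \<alpha> k f (t * \<beta>) j w (b * \<beta> + i, m))"
proof
  fix z :: "nat \<times> nat"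
  obtain i m where z: "z = (i, m)" by fastforce
  show "stored \<alpha> k f \<beta> j (\<lambda>(m, i, c). w (m, b * \<beta> + i, c)) z =
    (\<lambda>(i, m)\<in>{1..\<beta>} \<times> {1..f}. stored \<alpha> k f (t * \<beta>) j w (b * \<beta> + i, m)) z"
  proof (cases "z \<in> {1..\<beta>} \<times> {1..f}")
    case True
    have "b * \<beta> + i \<le> (b + 1) * \<beta>" using True z by simp
    also have "\<dots> \<le> t * \<beta>" using assms by (intro mult_right_mono) auto
    finally show ?thesis using True z by (auto simp: stored_def code_symbol_def)
  qed (auto simp: stored_def)
qed

lemma one_less_card_field: "1 < CARD('a::{finite, field})"
  using card_mono[of UNIV "{0, 1::'a}"] by simp

text \<open>
  A scheme with \<open>\<beta>\<close> rows is run on \<open>x\<close> blocks of \<open>\<beta>\<close> rows with one common key, and its answers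
  are padded with zeros to reach the exact download cost.
\<close>

lemma ppc_achievableI:
  fixes \<alpha> :: "nat \<Rightarrow> 'a::{finite, field}" and \<phi> :: "nat \<Rightarrow> 'a mpoly"
    and Q :: "nat \<Rightarrow> nat \<Rightarrow> 'k \<Rightarrow> 'k" and A :: "nat \<Rightarrow> 'k \<Rightarrow> (nat \<times> nat \<Rightarrow> 'a) \<Rightarrow> 'i \<Rightarrow> 'a"
  assumes G: "finite G" "G \<noteq> {}"
    and Q: "\<And>v j. v \<in> {1..\<mu>} \<Longrightarrow> j \<in> {1..n} \<Longrightarrow> Q v j ` G \<subseteq> G"
    and inj: "\<And>v j. v \<in> {1..\<mu>} \<Longrightarrow> j \<in> {1..n} \<Longrightarrow> inj_on (Q v j) G"
    and I: "\<And>j. j \<in> {1..n} \<Longrightarrow> finite (I j)"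
    and rec: "\<And>v s w w' r c. v \<in> {1..\<mu>} \<Longrightarrow> s \<in> G \<Longrightarrow>
      (\<And>j x. j \<in> {1..n} \<Longrightarrow> x \<in> I j \<Longrightarrow>
        A j (Q v j s) (stored \<alpha> k f \<beta> j w) x = A j (Q v j s) (stored \<alpha> k f \<beta> j w') x) \<Longrightarrow>
      r \<in> {1..\<beta>} \<Longrightarrow> c \<in> {1..k} \<Longrightarrow>
      eval_mpoly (\<phi> v) (\<lambda>m. w (m, r, c)) = eval_mpoly (\<phi> v) (\<lambda>m. w' (m, r, c))"
    and pos: "1 \<le> \<beta>" "1 \<le> k" "1 \<le> n" "0 < x" "0 < y"
    and rate: "x * (\<Sum>j=1..n. card (I j)) \<le> \<beta> * k * y"
  shows "ppc_achievable \<alpha> n k f \<mu> \<phi> (real x / real y * H_min f \<mu> \<phi>)"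
proof -
  note upt_Suc [simp del]
  define enc where "enc = to_nat_on G"
  define dec where "dec = from_nat_into G"
  have dec: "dec s \<in> G" for s using G by (simp add: dec_def from_nat_into)
  have dec_enc: "dec (enc s) = s" if "s \<in> G" for s
    using G that by (simp add: dec_def enc_def countable_finite)
  define D where "D = \<beta> * k * y"
  \<comment> \<open>By \<open>rate\<close> this subtraction does not truncate; database 1 returns
    the padding.\<close>
  define pad where "pad = D - x * (\<Sum>j=1..n. card (I j))"
  have "\<forall>j\<in>{1..n}. \<exists>xs. set xs = I j \<and> distinct xs"
    using I finite_distinct_list by blast
  then obtain en where en: "set (en j) = I j" "distinct (en j)" if "j \<in> {1..n}" for j
    by metis
  define block :: "nat \<Rightarrow> (nat \<times> nat \<Rightarrow> 'a) \<Rightarrow> nat \<times> nat \<Rightarrow> 'a" where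
    "block = (\<lambda>b C. (\<lambda>(i, m)\<in>{1..\<beta>} \<times> {1..f}. C (b * \<beta> + i, m)))"
  define resp where "resp j q C =
    concat (map (\<lambda>b. map (A j q (block b C)) (en j)) [0..<x]) @ (if j = 1 then replicate pad 0 else [])"
    for j q C
  define prot where "prot = \<lparr>key_pmf = map_pmf enc (pmf_of_set G),
    query = (\<lambda>v j s. Some (enc (Q v j (dec s)))), respond = (\<lambda>j q. resp j (dec q))\<rparr>"
  let ?\<beta> = "x * \<beta>"
  have ans: "answer_rv \<alpha> k f ?\<beta> prot v j (w, s) = resp j (Q v j (dec s)) (stored \<alpha> k f ?\<beta> j w)"
    if "v \<in> {1..\<mu>}" "j \<in> {1..n}" for v j w s
    using Q[OF that] dec[of s] by (auto simp: answer_rv_def prot_def dec_enc image_subset_iff)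
  have qry: "query_rv prot v j (w, s) = Some (enc (Q v j (dec s)))" for v j w s
    by (simp add: query_rv_def prot_def)
  have len: "length (resp j q C) = x * card (I j) + (if j = 1 then pad else 0)"
    if "j \<in> {1..n}" for j q C
    using en[OF that] distinct_card[of "en j"] by (simp add: resp_def length_concat comp_def sum_list_triv)

  have "ppc_downloads \<alpha> n k f \<mu> ?\<beta> prot D"
    unfolding ppc_downloads_def
  proof (intro ballI)
    fix v :: nat and \<omega> :: "'a messages \<times> nat" assume v: "v \<in> {1..\<mu>}"
    obtain w s where \<omega>: "\<omega> = (w, s)" by (cases \<omega>)
    have "(\<Sum>j=1..n. length (answer_rv \<alpha> k f ?\<beta> prot v j \<omega>))
        = (\<Sum>j=1..n. x * card (I j) + (if j = 1 then pad else 0))"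
      using v by (intro sum.cong refl) (simp add: \<omega> ans len)
    also have "\<dots> = x * (\<Sum>j=1..n. card (I j)) + pad"
      using pos by (simp add: sum.distrib sum_distrib_left)
    also have "\<dots> = D" using rate by (simp add: pad_def D_def)
    finally show "(\<Sum>j=1..n. length (answer_rv \<alpha> k f ?\<beta> prot v j \<omega>)) = D" .
  qed

  moreover have "ppc_private \<alpha> n k f \<mu> \<phi> ?\<beta> prot"
  proof -
    define M :: "'a messages pmf" where "M = message_pmf f ?\<beta> k"
    \<comment> \<open>The right-hand side is free of \<open>v\<close>: \<open>Q v j\<close> permutes
      \<open>G\<close>, so every database sees a uniform element of \<open>G\<close> that is
      independent of the messages.\<close>
    have "map_pmf (\<lambda>\<omega>. (query_rv prot v j \<omega>, answer_rv \<alpha> k f ?\<beta> prot v j \<omega>, fun_vectors \<phi> \<mu> k ?\<beta> (fst \<omega>)))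
          (joint_pmf f ?\<beta> k prot)
        = map_pmf (\<lambda>(w, q). (Some (enc q), resp j q (stored \<alpha> k f ?\<beta> j w), fun_vectors \<phi> \<mu> k ?\<beta> w))
            (pair_pmf M (pmf_of_set G))" (is "?L = _")
      if v: "v \<in> {1..\<mu>}" and j: "j \<in> {1..n}" for v j
    proof -
      have "bij_betw (Q v j) G G"
        using endo_inj_surj[OF G(1) Q[OF v j] inj[OF v j]] inj[OF v j] by (simp add: bij_betw_def)
      then have "map_pmf (Q v j) (pmf_of_set G) = pmf_of_set G"
        using G by (intro map_pmf_of_set_bij_betw)
      moreover have "?L = map_pmf (\<lambda>(w, s). (Some (enc (Q v j s)), resp j (Q v j s) (stored \<alpha> k f ?\<beta> j w),
            fun_vectors \<phi> \<mu> k ?\<beta> w)) (pair_pmf M (pmf_of_set G))"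
      proof -
        have "joint_pmf f ?\<beta> k prot = map_pmf (apsnd enc) (pair_pmf M (pmf_of_set G))"
          by (simp add: joint_pmf_def prot_def M_def pair_map_pmf2)
        moreover have "set_pmf (pmf_of_set G) = G" using G by (simp add: set_pmf_of_set)
        ultimately show ?thesis
          by (auto simp: pmf.map_comp ans[OF v j] qry dec_enc intro!: map_pmf_cong)
      qed
      moreover have "map_pmf (\<lambda>(w, q). (Some (enc q), resp j q (stored \<alpha> k f ?\<beta> j w), fun_vectors \<phi> \<mu> k ?\<beta> w))
            (pair_pmf M (map_pmf (Q v j) (pmf_of_set G)))
          = map_pmf (\<lambda>(w, s). (Some (enc (Q v j s)), resp j (Q v j s) (stored \<alpha> k f ?\<beta> j w),
            fun_vectors \<phi> \<mu> k ?\<beta> w)) (pair_pmf M (pmf_of_set G))"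
        by (auto simp: pair_map_pmf2 pmf.map_comp intro!: map_pmf_cong)
      ultimately show ?thesis by simp
    qed
    then show ?thesis unfolding ppc_private_def by simp
  qed

  moreover have "ppc_recovers \<alpha> n k f \<mu> \<phi> ?\<beta> prot"
    unfolding ppc_recovers_def
  proof
    fix v assume v: "v \<in> {1..\<mu>}"
    define X where "X = (\<lambda>\<omega> :: 'a messages \<times> nat. fun_vector \<phi> k ?\<beta> v (fst \<omega>))"
    define Y where "Y = (\<lambda>\<omega>. (map (\<lambda>j. answer_rv \<alpha> k f ?\<beta> prot v j \<omega>) [1..<n + 1],
              map (\<lambda>j. query_rv prot v j \<omega>) [1..<n + 1]))"
    have "X \<omega> = X \<omega>'" if eq: "Y \<omega> = Y \<omega>'" for \<omega> \<omega>'
    proof -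
      obtain w s w' s' where \<omega>: "\<omega> = (w, s)" "\<omega>' = (w', s')" by (cases \<omega>, cases \<omega>') blast
      \<comment> \<open>The keys \<open>dec s\<close> and \<open>dec s'\<close> may differ, but
        their queries agree, so both answers can be computed with \<open>dec s\<close>.\<close>
      have Qeq: "Q v j (dec s) = Q v j (dec s')"
        and Aeq: "resp j (Q v j (dec s)) (stored \<alpha> k f ?\<beta> j w)
          = resp j (Q v j (dec s')) (stored \<alpha> k f ?\<beta> j w')" if j: "j \<in> {1..n}" for j
      proof -
        have "query_rv prot v j \<omega> = query_rv prot v j \<omega>'"
          "answer_rv \<alpha> k f ?\<beta> prot v j \<omega> = answer_rv \<alpha> k f ?\<beta> prot v j \<omega>'"
          using eq j by (auto simp: Y_def)
        then have "enc (Q v j (dec s)) = enc (Q v j (dec s'))"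
          and "resp j (Q v j (dec s)) (stored \<alpha> k f ?\<beta> j w)
            = resp j (Q v j (dec s')) (stored \<alpha> k f ?\<beta> j w')"
          by (simp_all add: \<omega> qry ans[OF v j])
        moreover have "Q v j (dec s) \<in> G" "Q v j (dec s') \<in> G"
          using Q[OF v j] dec by blast+
        ultimately show "resp j (Q v j (dec s)) (stored \<alpha> k f ?\<beta> j w)
            = resp j (Q v j (dec s')) (stored \<alpha> k f ?\<beta> j w')"
          and "Q v j (dec s) = Q v j (dec s')"
          by (simp, metis dec_enc)
      qed
      have blk: "eval_mpoly (\<phi> v) (\<lambda>m. w (m, b * \<beta> + r, c)) = eval_mpoly (\<phi> v) (\<lambda>m. w' (m, b * \<beta> + r, c))"
        if b: "b < x" and r: "r \<in> {1..\<beta>}" and c: "c \<in> {1..k}" for b r c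
      proof -
        let ?w = "\<lambda>(m, i, c). w (m, b * \<beta> + i, c)" and ?w' = "\<lambda>(m, i, c). w' (m, b * \<beta> + i, c)"
        have "A j (Q v j (dec s)) (stored \<alpha> k f \<beta> j ?w) z = A j (Q v j (dec s)) (stored \<alpha> k f \<beta> j ?w') z"
          if j: "j \<in> {1..n}" and z: "z \<in> I j" for j z
        proof -
          have "concat (map (\<lambda>b. map (A j (Q v j (dec s)) (block b (stored \<alpha> k f ?\<beta> j w))) (en j)) [0..<x])
            = concat (map (\<lambda>b. map (A j (Q v j (dec s)) (block b (stored \<alpha> k f ?\<beta> j w'))) (en j)) [0..<x])"
            using Aeq[OF j] Qeq[OF j] by (simp add: resp_def)
          then have "map (\<lambda>b. map (A j (Q v j (dec s)) (block b (stored \<alpha> k f ?\<beta> j w))) (en j)) [0..<x]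
            = map (\<lambda>b. map (A j (Q v j (dec s)) (block b (stored \<alpha> k f ?\<beta> j w'))) (en j)) [0..<x]"
            by (rule concat_injective) (auto simp: set_zip)
          from arg_cong[OF this, of "\<lambda>xss. xss ! b"] b
          have "map (A j (Q v j (dec s)) (block b (stored \<alpha> k f ?\<beta> j w))) (en j)
            = map (A j (Q v j (dec s)) (block b (stored \<alpha> k f ?\<beta> j w'))) (en j)"
            by simp
          then show ?thesis
            using en(1)[OF j] z by (simp add: stored_block[OF b] block_def)
        qed
        from rec[OF v dec this r c] show ?thesis by simp
      qed
      have "fun_symbol \<phi> k v l w = fun_symbol \<phi> k v l w'" if l: "l \<in> {1..?\<beta> * k}" for l
      proof -
        \<comment> \<open>The zero-based row \<open>i\<close> is row
          \<open>i mod \<beta> + 1\<close> of block \<open>i div \<beta>\<close>.\<close>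
        define i where "i = (l - 1) div k"
        have "i < ?\<beta>" unfolding i_def using l pos by (intro less_mult_imp_div_less) auto
        then have "i div \<beta> < x" by (rule less_mult_imp_div_less)
        moreover have "i mod \<beta> + 1 \<in> {1..\<beta>}" using pos by (simp add: Suc_le_eq)
        moreover have "(l - 1) mod k + 1 \<in> {1..k}" using pos by (simp add: Suc_le_eq)
        ultimately have "eval_mpoly (\<phi> v) (\<lambda>m. w (m, i div \<beta> * \<beta> + (i mod \<beta> + 1), (l - 1) mod k + 1))
          = eval_mpoly (\<phi> v) (\<lambda>m. w' (m, i div \<beta> * \<beta> + (i mod \<beta> + 1), (l - 1) mod k + 1))"
          by (rule blk)
        moreover have "i div \<beta> * \<beta> + (i mod \<beta> + 1) = (l - 1) div k + 1"
          by (simp add: i_def)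
        ultimately show ?thesis by (simp add: fun_symbol_def message_symbol_def[abs_def])
      qed
      then show ?thesis by (simp add: X_def \<omega> fun_vector_def)
    qed
    then have X: "X \<omega> = (X \<circ> inv Y) (Y \<omega>)" for \<omega>
      by (metis comp_apply f_inv_into_f rangeI)
    \<comment> \<open>\<open>range Y\<close> includes outcomes of probability zero; they are covered
      because \<open>dec\<close> maps every number into \<open>G\<close>.\<close>
    have "finite (range Y)"
    proof (rule finite_subset)
      let ?N = "\<Sum>j=1..n. x * card (I j) + (if j = 1 then pad else 0)"
      let ?As = "{zs :: 'a list. set zs \<subseteq> UNIV \<and> length zs \<le> ?N}"
      let ?Bs = "Some ` enc ` G"
      have mem: "answer_rv \<alpha> k f ?\<beta> prot v j \<omega> \<in> ?As" "query_rv prot v j \<omega> \<in> ?Bs"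
        if "j \<in> {1..n}" for j \<omega>
      proof -
        obtain w s where \<omega>: "\<omega> = (w, s)" by (cases \<omega>)
        have "x * card (I j) + (if j = 1 then pad else 0) \<le> ?N"
          using that by (intro member_le_sum) auto
        then show "answer_rv \<alpha> k f ?\<beta> prot v j \<omega> \<in> ?As"
          using that v by (simp add: \<omega> ans len)
        show "query_rv prot v j \<omega> \<in> ?Bs"
          using Q[OF v that] dec[of s] by (auto simp: \<omega> qry image_subset_iff)
      qed
      then show "range Y \<subseteq> {zs. set zs \<subseteq> ?As \<and> length zs = n} \<times> {zs. set zs \<subseteq> ?Bs \<and> length zs = n}"
        by (auto simp: Y_def)
      show "finite ({zs. set zs \<subseteq> ?As \<and> length zs = n} \<times> {zs. set zs \<subseteq> ?Bs \<and> length zs = n})"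
        using G by (intro finite_cartesian_product finite_lists_length_eq finite_lists_length_le finite_imageI) auto
    qed
    with X have "discrete_cond_entropy (real CARD('a)) (joint_pmf f ?\<beta> k prot) X Y = 0"
      using one_less_card_field[where 'a = 'a] by (intro discrete_cond_entropy_eq_0) simp_all
    then show "discrete_cond_entropy (real CARD('a)) (joint_pmf f ?\<beta> k prot)
        (\<lambda>\<omega>. fun_vector \<phi> k ?\<beta> v (fst \<omega>))
        (\<lambda>\<omega>. (map (\<lambda>j. answer_rv \<alpha> k f ?\<beta> prot v j \<omega>) [1..<n + 1],
              map (\<lambda>j. query_rv prot v j \<omega>) [1..<n + 1])) = 0"
      by (simp add: X_def Y_def)
  qed

  moreover have "real x / real y * H_min f \<mu> \<phi> = real (?\<beta> * k) * H_min f \<mu> \<phi> / real D"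
    using pos by (simp add: D_def field_simps)
  moreover have "1 \<le> ?\<beta>" "0 < D" using pos by (simp_all add: D_def Suc_le_eq)
  ultimately show ?thesis unfolding ppc_achievable_def by blast
qed

section \<open>Redundancy of alternating sums\<close>

text \<open>For \<open>i \<notin> S\<close>, the sign that sorts the product of \<open>e i\<close>
  and the ordered wedge product \<open>e S\<close> into increasing order. As \<open>i\<close> itself
  is not counted, \<open>insert i S\<close> has the same sign.\<close>

definition ksign :: "nat \<Rightarrow> nat set \<Rightarrow> 'a::comm_ring_1" where
  "ksign i S = (-1) ^ card {j \<in> S. j < i}"

lemma ksign_empty [simp]: "ksign i {} = 1"
  by (simp add: ksign_def)

lemma ksign_square [simp]: "ksign i S * ksign i S = 1"
  by (simp add: ksign_def flip: power_add mult_2)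

lemma ksign_square_left [simp]: "ksign i S * (ksign i S * x) = x"
  by (simp flip: mult.assoc)

lemma ksign_nonzero [simp]: "(ksign i S :: 'a::idom) \<noteq> 0"
  by (simp add: ksign_def)

lemma ksign_insert:
  assumes "j \<notin> S"
  shows "ksign i (insert j S) = (if j < i then - ksign i S else ksign i S)"
proof -
  have "{l \<in> insert j S. l < i} = (if j < i then insert j {l \<in> S. l < i} else {l \<in> S. l < i})"
    by auto
  then show ?thesis using assms by (simp add: ksign_def)
qed

lemma ksign_insert_same [simp]: "ksign i (insert i S) = ksign i S"
  by (cases "i \<in> S") (simp_all add: insert_absorb ksign_insert)

lemma ksign_remove_same [simp]: "ksign i (S - {i}) = ksign i S"
  by (metis insert_Diff_single ksign_insert_same)

text \<open>Exactly one of \<open>v < i\<close> and \<open>i < v\<close> holds, so exactly one of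
  the two signs flips. In the scheme this gives the interference in a sum over
  \<open>insert v T\<close> the signs of the sum over \<open>T\<close>.\<close>

lemma ksign_swap:
  assumes "i \<noteq> v" "i \<in> T" "v \<notin> T"
  shows "ksign i (insert v T) * ksign v (T - {i}) = - (ksign v T * ksign i T :: 'a::comm_ring_1)"
proof -
  have "ksign v T = (if i < v then - ksign v (T - {i}) else ksign v (T - {i}) :: 'a)"
    using ksign_insert[of i "T - {i}" v] assms by (simp add: insert_absorb)
  then show ?thesis using assms by (auto simp: ksign_insert mult.commute)
qed

text \<open>
  An element of the exterior algebra is encoded as the function \<open>y\<close> of its coefficients \<open>y T\<close> on the
  basis vectors \<open>e\<^sub>T\<close>; \<open>contract i\<close> and \<open>wedge s\<close> are the annihilation and creation operators.
\<close>

definition contract :: "nat \<Rightarrow> (nat set \<Rightarrow> 'a::comm_ring_1) \<Rightarrow> nat set \<Rightarrow> 'a" where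
  "contract i y T = (if i \<in> T then 0 else ksign i T * y (insert i T))"

definition wedge :: "nat \<Rightarrow> (nat set \<Rightarrow> 'a::comm_ring_1) \<Rightarrow> nat set \<Rightarrow> 'a" where
  "wedge s y T = (if s \<in> T then ksign s T * y (T - {s}) else 0)"

text \<open>The canonical anticommutation relation of annihilation and creation operators.\<close>

lemma contract_wedge:
  "contract i (wedge s y) T = (if i = s then y T else 0) - wedge s (contract i y) T"
proof -
  consider "i = s" | "i \<noteq> s" "i \<notin> T" "s \<in> T" | "i \<noteq> s" "i \<in> T \<or> s \<notin> T" by blast
  then show ?thesis
  proof cases
    case 1
    then show ?thesis by (auto simp: contract_def wedge_def insert_absorb)
  next
    case 2
    then have "ksign s (insert i T) * ksign i (T - {s}) = - (ksign i T * ksign s T :: 'a)"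
      by (intro ksign_swap) auto
    moreover have "insert i T - {s} = insert i (T - {s})" using 2 by auto
    moreover have "ksign s (insert i T) = (if i < s then - ksign s T else ksign s T :: 'a)"
      and "ksign i T = (if s < i then - ksign i (T - {s}) else ksign i (T - {s}) :: 'a)"
      using 2 ksign_insert[of i T s] ksign_insert[of s "T - {s}" i] by (simp_all add: insert_absorb)
    ultimately show ?thesis using 2
      by (auto simp: contract_def wedge_def mult_ac not_less split: if_splits)
  qed (auto simp: contract_def wedge_def)
qed

lemma contract_linear:
  "contract i (\<lambda>T. y T - (\<Sum>p\<in>P. c p * z p T)) T = contract i y T - (\<Sum>p\<in>P. c p * contract i (z p) T)"
  by (simp add: contract_def right_diff_distrib sum_distrib_left mult_ac)

lemma wedge_sum: "wedge s (\<lambda>T. \<Sum>i\<in>V. c i * z i T) T = (\<Sum>i\<in>V. c i * wedge s (z i) T)"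
  by (simp add: wedge_def sum_distrib_left mult_ac)

text \<open>
  If the vectors \<open>x i\<close> satisfy \<open>x i = (\<Sum>p\<in>P. c i p * x p)\<close>, then \<open>e s - (\<Sum>p\<in>P. c s p * e p)\<close>
  spans the kernel of \<open>e i \<mapsto> x i\<close>; products of such elements are annihilated by the map
  \<open>e S \<mapsto> (\<Sum>i\<in>S. ksign i S * x i \<otimes> e (S - {i}))\<close>.
\<close>

definition wedge_ker :: "nat set \<Rightarrow> (nat \<Rightarrow> nat \<Rightarrow> 'a::comm_ring_1) \<Rightarrow> nat \<Rightarrow> (nat set \<Rightarrow> 'a) \<Rightarrow> nat set \<Rightarrow> 'a" where
  "wedge_ker P c s y T = wedge s y T - (\<Sum>p\<in>P. c s p * wedge p y T)"

definition ker_product :: "nat set \<Rightarrow> (nat \<Rightarrow> nat \<Rightarrow> 'a::comm_ring_1) \<Rightarrow> nat list \<Rightarrow> nat set \<Rightarrow> 'a" where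
  "ker_product P c xs = foldr (wedge_ker P c) xs (\<lambda>T. if T = {} then 1 else 0)"

text \<open>By the anticommutation relation, the operator
  \<open>\<Sum>i\<in>V. c i p * contract i\<close> passes through \<open>wedge t\<close> with a sign
  change and leaves the scalar \<open>c t p\<close>. For a factor of the product these scalars add
  up to \<open>c s p - c s p\<close>, as \<open>c\<close> is the identity on \<open>P\<close>, and
  the operator kills the unit.\<close>

lemma contract_ker_product:
  assumes "finite V" "P \<subseteq> V" and c: "\<And>p q. p \<in> P \<Longrightarrow> q \<in> P \<Longrightarrow> c p q = (if p = q then 1 else 0)"
    and "set xs \<subseteq> V" "p \<in> P"
  shows "(\<Sum>i\<in>V. c i p * contract i (ker_product P c xs) T) = 0"
  using \<open>set xs \<subseteq> V\<close>
proof (induction xs arbitrary: T)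
  case Nil
  have "contract i (ker_product P c []) T = 0" for i
    by (simp add: ker_product_def contract_def)
  then show ?case by simp
next
  case (Cons s xs)
  have fin: "finite P" using assms(1,2) finite_subset by blast
  define y where "y = ker_product P c xs"
  have IH: "(\<Sum>i\<in>V. c i p * contract i y T) = 0" for T
    using Cons by (simp add: y_def)
  have W: "(\<Sum>i\<in>V. c i p * wedge t (contract i y) T) = 0" for t
    unfolding wedge_sum[symmetric] IH by (simp add: wedge_def)
  have CW: "(\<Sum>i\<in>V. c i p * contract i (wedge t y) T) = c t p * y T" if "t \<in> V" for t
  proof -
    have "(\<Sum>i\<in>V. c i p * contract i (wedge t y) T)
        = (\<Sum>i\<in>V. c i p * (if i = t then y T else 0)) - (\<Sum>i\<in>V. c i p * wedge t (contract i y) T)"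
      by (simp only: contract_wedge right_diff_distrib sum_subtractf)
    also have "\<dots> = c t p * y T"
      using that \<open>finite V\<close> by (simp add: W if_distrib[of "(*) _"] cong: if_cong)
    finally show ?thesis .
  qed
  have "(\<Sum>i\<in>V. c i p * contract i (ker_product P c (s # xs)) T)
      = (\<Sum>i\<in>V. c i p * contract i (wedge s y) T - (\<Sum>q\<in>P. c s q * (c i p * contract i (wedge q y) T)))"
    by (simp add: ker_product_def flip: y_def)
      (simp add: wedge_ker_def[abs_def] y_def ker_product_def contract_linear right_diff_distrib sum_distrib_left mult_ac)
  also have "\<dots> = (\<Sum>i\<in>V. c i p * contract i (wedge s y) T)
      - (\<Sum>q\<in>P. c s q * (\<Sum>i\<in>V. c i p * contract i (wedge q y) T))"
    by (simp add: sum_subtractf sum_distrib_left) (rule sum.swap)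
  also have "\<dots> = c s p * y T - (\<Sum>q\<in>P. c s q * (c q p * y T))"
    using Cons.prems assms(2) by (intro arg_cong2[where f = minus] sum.cong) (auto simp: CW subset_iff)
  also have "(\<Sum>q\<in>P. c s q * (c q p * y T)) = (\<Sum>q\<in>P. if q = p then c s q * y T else 0)"
    using c \<open>p \<in> P\<close> by (intro sum.cong) auto
  also have "\<dots> = c s p * y T" using fin \<open>p \<in> P\<close> by simp
  finally show ?case by simp
qed

text \<open>Every factor raises the degree in the exterior algebra by one.\<close>

lemma ker_product_support:
  assumes "P \<subseteq> V" "set xs \<subseteq> V" "ker_product P c xs T \<noteq> 0"
  shows "T \<subseteq> V \<and> finite T \<and> card T = length xs"
  using assms(2,3)
proof (induction xs arbitrary: T)
  case Nil
  then show ?case by (simp add: ker_product_def split: if_splits)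
next
  case (Cons s xs)
  let ?y = "ker_product P c xs"
  have "wedge s ?y T \<noteq> 0 \<or> (\<exists>p\<in>P. wedge p ?y T \<noteq> 0)"
  proof (rule ccontr)
    assume "\<not> ?thesis"
    then have "ker_product P c (s # xs) T = 0"
      by (simp add: ker_product_def wedge_ker_def)
    with Cons.prems show False by blast
  qed
  then obtain t where t: "t \<in> V" "wedge t ?y T \<noteq> 0"
    using assms(1) Cons.prems by auto
  then have "t \<in> T" "?y (T - {t}) \<noteq> 0" by (auto simp: wedge_def split: if_splits)
  then have "T - {t} \<subseteq> V" "finite (T - {t})" "card (T - {t}) = length xs"
    using Cons.IH[of "T - {t}"] Cons.prems(1) by auto
  moreover from this have "card T = Suc (card (T - {t}))"
    using \<open>t \<in> T\<close> by (intro card.remove) simp_all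
  ultimately show ?case using t(1) by auto
qed

text \<open>Away from \<open>P\<close> the correction terms \<open>wedge p\<close> vanish. What
  remains is the product of the \<open>wedge s\<close>, whose only coefficient is a sign.\<close>

lemma ker_product_outside:
  assumes "T \<inter> P = {}" "distinct xs"
  shows "(ker_product P c xs T :: 'a::idom) \<noteq> 0 \<longleftrightarrow> T = set xs"
  using assms
proof (induction xs arbitrary: T)
  case Nil
  then show ?case by (simp add: ker_product_def)
next
  case (Cons s xs)
  have "wedge p (ker_product P c xs) T = 0" if "p \<in> P" for p
    using that Cons.prems by (auto simp: wedge_def)
  then have "ker_product P c (s # xs) T = wedge s (ker_product P c xs) T"
    by (simp add: ker_product_def wedge_ker_def)
  moreover have "ker_product P c xs (T - {s}) \<noteq> 0 \<longleftrightarrow> T - {s} = set xs"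
    using Cons by (intro Cons.IH) auto
  ultimately show ?case using Cons.prems by (auto simp: wedge_def)
qed

text \<open>The alternating sums are paired with the coefficients of a kernel element whose only
  term away from \<open>P\<close> is \<open>S\<close>. The pairing is zero, and so are its terms at
  sets that meet \<open>P\<close>, by \<open>zero\<close>; hence the term at \<open>S\<close> is
  zero.\<close>

lemma alternating_sum_redundant:
  fixes x :: "nat \<Rightarrow> nat set \<Rightarrow> 'a::field"
  assumes V: "finite V" "P \<subseteq> V"
    and c: "\<And>p q. p \<in> P \<Longrightarrow> q \<in> P \<Longrightarrow> c p q = (if p = q then 1 else 0)"
    and x: "\<And>i T. i \<in> V \<Longrightarrow> x i T = (\<Sum>p\<in>P. c i p * x p T)"
    and zero: "\<And>S. S \<subseteq> V \<Longrightarrow> card S = t \<Longrightarrow> S \<inter> P \<noteq> {} \<Longrightarrow> (\<Sum>i\<in>S. ksign i S * x i (S - {i})) = 0"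
    and S: "S \<subseteq> V" "card S = t"
  shows "(\<Sum>i\<in>S. ksign i S * x i (S - {i})) = 0"
proof (cases "S \<inter> P = {}")
  case True
  define q where "q S = (\<Sum>i\<in>S. ksign i S * x i (S - {i}))" for S
  have finS: "finite S" using S V finite_subset by blast
  then obtain xs where xs: "set xs = S" "distinct xs" using finite_distinct_list by blast
  define y where "y = ker_product P c xs"
  have y0: "y S \<noteq> 0" using ker_product_outside[OF True xs(2), of c] xs by (simp add: y_def)
  have fin: "finite T" if "T \<subseteq> V" for T using that V finite_subset by blast
  have other: "y T * q T = 0" if "T \<subseteq> V" "T \<noteq> S" for T
  proof (cases "y T = 0")
    case False
    then have "T \<inter> P \<noteq> {}" using ker_product_outside[of T P xs c] xs that by (auto simp: y_def)
    moreover have "card T = t"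
      using ker_product_support[of P V xs c T] V False xs S distinct_card[of xs] by (simp add: y_def)
    ultimately show ?thesis using zero that by (simp add: q_def)
  qed simp
  have "y S * q S = (\<Sum>T\<in>Pow V. y T * q T)"
  proof -
    have "(\<Sum>T\<in>Pow V - {S}. y T * q T) = 0"
      using other by (intro sum.neutral) blast
    then show ?thesis using S V by (subst sum.remove[of "Pow V" S]) simp_all
  qed
  also have "\<dots> = (\<Sum>(T, i)\<in>Sigma (Pow V) (\<lambda>T. T). y T * (ksign i T * x i (T - {i})))"
    using V fin by (subst sum.Sigma[symmetric]) (auto simp: q_def sum_distrib_left)
  \<comment> \<open>Replacing \<open>T\<close> by \<open>T - {i}\<close> turns the coefficients of
    \<open>y\<close> into those of \<open>contract i y\<close>.\<close>
  also have "\<dots> = (\<Sum>(T, i)\<in>Sigma (Pow V) (\<lambda>T. V - T). y (insert i T) * (ksign i T * x i T))"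
    by (rule sum.reindex_bij_witness[where i = "\<lambda>(T, i). (insert i T, i)" and j = "\<lambda>(T, i). (T - {i}, i)"])
      (auto simp: insert_absorb)
  also have "\<dots> = (\<Sum>T\<in>Pow V. \<Sum>i\<in>V - T. contract i y T * x i T)"
    using V by (subst sum.Sigma[symmetric]) (auto simp: contract_def mult_ac intro!: sum.cong)
  also have "\<dots> = (\<Sum>T\<in>Pow V. \<Sum>i\<in>V. contract i y T * x i T)"
    using V by (intro sum.cong sum.mono_neutral_left) (auto simp: contract_def)
  \<comment> \<open>Expanding \<open>x i\<close> in the \<open>x p\<close> collects, for each
    \<open>p\<close>, the contraction sum that vanishes on \<open>y\<close>.\<close>
  also have "\<dots> = (\<Sum>T\<in>Pow V. \<Sum>i\<in>V. \<Sum>p\<in>P. x p T * (c i p * contract i y T))"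
    by (intro sum.cong refl) (subst x, auto simp: sum_distrib_left mult_ac)
  also have "\<dots> = (\<Sum>T\<in>Pow V. \<Sum>p\<in>P. x p T * (\<Sum>i\<in>V. c i p * contract i y T))"
    unfolding sum_distrib_left by (intro sum.cong[OF refl] sum.swap)
  also have "\<dots> = 0"
    using contract_ker_product[OF V c, of xs] xs S by (simp add: y_def)
  finally show ?thesis using y0 by (simp add: q_def)
next
  case False
  then show ?thesis using zero S by blast
qed

section \<open>The retrieval scheme\<close>

text \<open>The word lengths are functions of \<open>card T\<close>, so that both labels, with
  lengths \<open>\<mu> - t\<close> and \<open>t\<close>, and indices of sums, with lengths
  \<open>\<mu> + 1 - t\<close> and \<open>t - 1\<close>, are instances.\<close>

definition word_triples :: "nat \<Rightarrow> nat \<Rightarrow> (nat \<Rightarrow> nat) \<Rightarrow> (nat \<Rightarrow> nat) \<Rightarrow> nat set set \<Rightarrow> (nat list \<times> nat list \<times> nat set) set" where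
  "word_triples \<kappa> \<delta> a b \<S> = {(P, z, T). T \<in> \<S> \<and> set P \<subseteq> {..<\<kappa>} \<and> length P = a (card T) \<and>
     set z \<subseteq> {..<\<delta>} \<and> length z = b (card T)}"

lemma word_triples_eq:
  "word_triples \<kappa> \<delta> a b \<S> = (\<lambda>(T, P, z). (P, z, T)) ` (SIGMA T:\<S>.
     {P. set P \<subseteq> {..<\<kappa>} \<and> length P = a (card T)} \<times> {z. set z \<subseteq> {..<\<delta>} \<and> length z = b (card T)})"
  unfolding word_triples_def by force

lemma finite_word_triples: "finite \<S> \<Longrightarrow> finite (word_triples \<kappa> \<delta> a b \<S>)"
  unfolding word_triples_eq by (intro finite_imageI finite_SigmaI finite_cartesian_product finite_lists_length_eq) auto

lemma card_word_triples:
  assumes "finite \<S>"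
  shows "card (word_triples \<kappa> \<delta> a b \<S>) = (\<Sum>T\<in>\<S>. \<kappa> ^ a (card T) * \<delta> ^ b (card T))"
proof -
  have "inj_on (\<lambda>(T, P, z). (P, z, T)) A" for A :: "(nat set \<times> nat list \<times> nat list) set"
    by (auto simp: inj_on_def)
  then show ?thesis
    unfolding word_triples_eq using assms
    by (simp add: card_image card_SigmaI card_cartesian_product card_lists_length_eq finite_lists_length_eq)
qed

lemma sum_Pow_power:
  assumes "finite A"
  shows "(\<Sum>T\<in>Pow A. x ^ (card A - card T) * y ^ card T) = (x + y :: 'b::comm_semiring_1) ^ card A"
proof -
  have "(x + y) ^ card A = (\<Prod>i\<in>A. y + x)" by (simp add: add.commute)
  also have "\<dots> = (\<Sum>T\<in>Pow A. (\<Prod>i\<in>T. y) * (\<Prod>i\<in>A - T. x))"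
    by (rule prod_add[OF assms])
  also have "\<dots> = (\<Sum>T\<in>Pow A. x ^ (card A - card T) * y ^ card T)"
    using assms by (intro sum.cong) (auto simp: card_Diff_subset finite_subset mult.commute)
  finally show ?thesis ..
qed

text \<open>
  In a label \<open>(P, z, T)\<close>, \<open>P\<close> is a word over \<open>\<kappa>\<close> letters and \<open>z\<close> one over \<open>\<delta>\<close> letters. For a fixed
  \<open>v\<close>, the label is read as a row number \<open>a < \<kappa> + \<delta>\<close> (the first letter of \<open>P\<close> if \<open>v \<notin> T\<close>, or \<open>\<kappa>\<close> plus
  the first letter of \<open>z\<close> if \<open>v \<in> T\<close>) together with the rest.
\<close>

definition labels :: "nat \<Rightarrow> nat \<Rightarrow> nat \<Rightarrow> (nat list \<times> nat list \<times> nat set) set" where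
  "labels \<kappa> \<delta> \<mu> = word_triples \<kappa> \<delta> (\<lambda>t. \<mu> - t) (\<lambda>t. t) (Pow {1..\<mu>})"

definition mk_label :: "nat \<Rightarrow> nat \<Rightarrow> nat \<Rightarrow> nat list \<Rightarrow> nat list \<Rightarrow> nat set \<Rightarrow> nat list \<times> nat list \<times> nat set" where
  "mk_label \<kappa> v a p z T = (if a < \<kappa> then (a # p, z, T) else (p, (a - \<kappa>) # z, insert v T))"

fun relabel :: "nat \<Rightarrow> nat \<Rightarrow> (nat \<Rightarrow> nat) \<Rightarrow> nat list \<times> nat list \<times> nat set \<Rightarrow> nat list \<times> nat list \<times> nat set" where
  "relabel \<kappa> v \<theta> (P, z, T) = (if v \<in> T then mk_label \<kappa> v (\<theta> (\<kappa> + hd z)) P (tl z) (T - {v})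
     else mk_label \<kappa> v (\<theta> (hd P)) (tl P) z T)"

lemma finite_labels: "finite (labels \<kappa> \<delta> \<mu>)"
  by (simp add: labels_def finite_word_triples)

text \<open>This is the binomial theorem. The scheme uses this number of rows, one per
  label.\<close>

lemma card_labels: "card (labels \<kappa> \<delta> \<mu>) = (\<kappa> + \<delta>) ^ \<mu>"
  using sum_Pow_power[of "{1..\<mu>}" \<kappa> \<delta>] by (simp add: labels_def card_word_triples)

lemma relabel_mk_label: "v \<notin> T \<Longrightarrow> relabel \<kappa> v \<theta> (mk_label \<kappa> v a p z T) = mk_label \<kappa> v (\<theta> a) p z T"
  by (simp add: mk_label_def)

lemma mk_label_in_labels:
  assumes "v \<in> {1..\<mu>}" "T \<subseteq> {1..\<mu>} - {v}" "a < \<kappa> + \<delta>"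
    and "set p \<subseteq> {..<\<kappa>}" "length p = \<mu> - 1 - card T" "set z \<subseteq> {..<\<delta>}" "length z = card T"
  shows "mk_label \<kappa> v a p z T \<in> labels \<kappa> \<delta> \<mu>"
proof -
  have "finite T" using assms(2) finite_subset by blast
  moreover have "card T \<le> card ({1..\<mu>} - {v})" using assms(2) by (intro card_mono) auto
  moreover have "v \<notin> T" using assms(2) by blast
  ultimately show ?thesis using assms
    by (auto simp: mk_label_def labels_def word_triples_def)
qed

lemma labels_cases:
  assumes "l \<in> labels \<kappa> \<delta> \<mu>" "v \<in> {1..\<mu>}"
  obtains a p z T where "l = mk_label \<kappa> v a p z T" "T \<subseteq> {1..\<mu>} - {v}" "a < \<kappa> + \<delta>"
    "set p \<subseteq> {..<\<kappa>}" "length p = \<mu> - 1 - card T" "set z \<subseteq> {..<\<delta>}" "length z = card T"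
proof -
  obtain P z T where l: "l = (P, z, T)" and T: "T \<subseteq> {1..\<mu>}" and P: "set P \<subseteq> {..<\<kappa>}" "length P = \<mu> - card T"
    and z: "set z \<subseteq> {..<\<delta>}" "length z = card T"
    using assms(1) by (auto simp: labels_def word_triples_def)
  have fin: "finite T" using T finite_subset by blast
  show ?thesis
  proof (cases "v \<in> T")
    case True
    then have "card T \<noteq> 0" using fin by auto
    then obtain b z' where z': "z = b # z'" using z by (cases z) auto
    show ?thesis
      using True z' l T P z fin
      by (intro that[of "\<kappa> + b" P z' "T - {v}"]) (auto simp: mk_label_def insert_absorb card_Diff_singleton)
  next
    case False
    then have "card T \<le> card ({1..\<mu>} - {v})" using T by (intro card_mono) auto
    then have "length P \<noteq> 0" using assms(2) P by auto
    then obtain a p where P': "P = a # p" by (cases P) auto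
    show ?thesis
      using False P' l T P z by (intro that[of a p z T]) (auto simp: mk_label_def)
  qed
qed

text \<open>\<open>relabel\<close> applies \<open>\<theta>\<close> to the row number and keeps the
  rest, so the inverse permutation gives the inverse map.\<close>

lemma relabel_bij:
  assumes \<theta>: "\<theta> permutes {..<\<kappa> + \<delta>}" and v: "v \<in> {1..\<mu>}"
  shows "bij_betw (relabel \<kappa> v \<theta>) (labels \<kappa> \<delta> \<mu>) (labels \<kappa> \<delta> \<mu>)"
proof (rule bij_betwI)
  have maps: "relabel \<kappa> v \<theta> \<in> labels \<kappa> \<delta> \<mu> \<rightarrow> labels \<kappa> \<delta> \<mu>" if "\<theta> permutes {..<\<kappa> + \<delta>}" for \<theta>
  proof
    fix l assume "l \<in> labels \<kappa> \<delta> \<mu>"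
    then show "relabel \<kappa> v \<theta> l \<in> labels \<kappa> \<delta> \<mu>"
    proof (rule labels_cases[OF _ v])
      fix a p z T
      assume *: "l = mk_label \<kappa> v a p z T" "T \<subseteq> {1..\<mu>} - {v}" "a < \<kappa> + \<delta>"
        "set p \<subseteq> {..<\<kappa>}" "length p = \<mu> - 1 - card T" "set z \<subseteq> {..<\<delta>}" "length z = card T"
      moreover have "\<theta> a < \<kappa> + \<delta>" using permutes_in_image[OF that, of a] *(3) by simp
      moreover have "relabel \<kappa> v \<theta> l = mk_label \<kappa> v (\<theta> a) p z T"
        unfolding *(1) by (rule relabel_mk_label) (use *(2) in blast)
      ultimately show ?thesis using v by (simp add: mk_label_in_labels)
    qed
  qed
  show "relabel \<kappa> v \<theta> \<in> labels \<kappa> \<delta> \<mu> \<rightarrow> labels \<kappa> \<delta> \<mu>"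
    and "relabel \<kappa> v (inv \<theta>) \<in> labels \<kappa> \<delta> \<mu> \<rightarrow> labels \<kappa> \<delta> \<mu>"
    using \<theta> by (auto intro!: maps permutes_inv)
  have cancel: "relabel \<kappa> v \<eta> (relabel \<kappa> v \<theta> l) = l"
    if "l \<in> labels \<kappa> \<delta> \<mu>" "\<And>a. \<eta> (\<theta> a) = a" for l \<eta> \<theta>
    using that(1)
  proof (rule labels_cases[OF _ v])
    fix a p z T assume *: "l = mk_label \<kappa> v a p z T" "T \<subseteq> {1..\<mu>} - {v}"
    have "v \<notin> T" using *(2) by blast
    then show ?thesis by (simp add: *(1) relabel_mk_label that(2) del: relabel.simps)
  qed
  show "relabel \<kappa> v (inv \<theta>) (relabel \<kappa> v \<theta> l) = l" "relabel \<kappa> v \<theta> (relabel \<kappa> v (inv \<theta>) l) = l"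
    if "l \<in> labels \<kappa> \<delta> \<mu>" for l
    using cancel[OF that] permutes_inverses[OF \<theta>] by auto
qed

text \<open>
  A key assigns to every label a row of the messages and a nonzero scalar. A database sees it
  through a bijection of the labels and a rescaling that depend on \<open>v\<close>. Since this is an injection of
  \<open>key_space\<close> into itself, a uniform key is seen as a uniform key.
\<close>

definition key_space :: "'l set \<Rightarrow> nat \<Rightarrow> ('l \<Rightarrow> nat \<times> 'a::{finite, field}) set" where
  "key_space L \<beta> = {R \<in> L \<rightarrow>\<^sub>E {1..\<beta>} \<times> (UNIV - {0}). inj_on (fst \<circ> R) L}"

definition transform_key :: "'l set \<Rightarrow> ('l \<Rightarrow> 'l) \<Rightarrow> ('l \<Rightarrow> 'a) \<Rightarrow> ('l \<Rightarrow> nat \<times> 'a::{finite, field}) \<Rightarrow> 'l \<Rightarrow> nat \<times> 'a" where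
  "transform_key L U s R = (\<lambda>l\<in>L. (fst (R (U l)), s l * snd (R (U l))))"

lemma finite_key_space: "finite L \<Longrightarrow> finite (key_space L \<beta>)"
  unfolding key_space_def by (rule finite_subset[of _ "L \<rightarrow>\<^sub>E {1..\<beta>} \<times> (UNIV - {0})"]) (auto intro: finite_PiE)

lemma key_space_nonempty:
  assumes "finite L" "card L = \<beta>"
  shows "(key_space L \<beta> :: ('l \<Rightarrow> nat \<times> 'a::{finite, field}) set) \<noteq> {}"
proof -
  obtain h where h: "bij_betw h L {1..\<beta>}"
    using finite_same_card_bij[of L "{1..\<beta>}"] assms by auto
  have "(\<lambda>l\<in>L. (h l, 1)) \<in> (key_space L \<beta> :: ('l \<Rightarrow> nat \<times> 'a) set)"
    using h by (auto simp: key_space_def bij_betw_def inj_on_def)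
  then show ?thesis by blast
qed

lemma transform_key_in_key_space:
  assumes "bij_betw U L L" "\<And>l. l \<in> L \<Longrightarrow> s l \<noteq> 0"
  shows "transform_key L U s ` key_space L \<beta> \<subseteq> key_space L \<beta>"
proof
  fix R' assume "R' \<in> transform_key L U s ` key_space L \<beta>"
  then obtain R where R: "R \<in> key_space L \<beta>" "R' = transform_key L U s R" by blast
  have U: "U l \<in> L" if "l \<in> L" for l using assms(1) that by (auto simp: bij_betw_def)
  have "R l \<in> {1..\<beta>} \<times> (UNIV - {0})" if "l \<in> L" for l
    using R(1) that by (auto simp: key_space_def PiE_mem)
  then have "R' \<in> L \<rightarrow>\<^sub>E {1..\<beta>} \<times> (UNIV - {0})"
    using U assms(2) by (auto simp: R(2) transform_key_def mem_Times_iff)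
  moreover have "inj_on ((fst \<circ> R) \<circ> U) L"
    using R(1) assms(1) by (intro comp_inj_on[of U L "fst \<circ> R"]) (simp_all add: key_space_def bij_betw_def)
  then have "inj_on (fst \<circ> R') L"
    by (auto simp: R(2) transform_key_def inj_on_def)
  ultimately show "R' \<in> key_space L \<beta>" by (simp add: key_space_def)
qed

lemma transform_key_inj:
  assumes U: "bij_betw U L L" and s: "\<And>l. l \<in> L \<Longrightarrow> s l \<noteq> 0"
  shows "inj_on (transform_key L U s) (key_space L \<beta>)"
proof (rule inj_onI)
  fix R R' assume R: "R \<in> key_space L \<beta>" "R' \<in> key_space L \<beta>" and eq: "transform_key L U s R = transform_key L U s R'"
  have "R l = R' l" if l: "l \<in> L" for l
  proof -
    obtain l' where l': "l' \<in> L" "l = U l'" using U l by (auto simp: bij_betw_def)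
    have "transform_key L U s R l' = transform_key L U s R' l'" using eq by simp
    then show ?thesis using l' s[of l'] by (simp add: transform_key_def prod_eq_iff)
  qed
  then show "R = R'"
    using R by (intro extensionalityI[of R L]) (auto simp: key_space_def PiE_def)
qed

text \<open>The user puts this sign into the scalars of the key, where uniformity hides it. With it,
  the interference in a sum containing \<open>v\<close> agrees up to a common factor with the sum
  without \<open>v\<close>.\<close>

definition side_sign :: "nat \<Rightarrow> nat list \<times> nat list \<times> nat set \<Rightarrow> 'a::comm_ring_1" where
  "side_sign v l = (if v \<in> snd (snd l) then ksign v (snd (snd l)) else 1)"

lemma side_sign_nonzero: "(side_sign v l :: 'a::idom) \<noteq> 0"
  by (simp add: side_sign_def)

text \<open>
  Of the \<open>\<kappa> + \<delta>\<close> row numbers, database \<open>j\<close> returns the desired function on \<open>\<theta> j 0, \<dots>, \<theta> j (\<kappa> - 1)\<close>,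
  masked by the interference of the rows \<open>\<theta> j \<kappa>, \<dots>, \<theta> j (\<kappa> + \<delta> - 1)\<close>, which other databases return unmasked.
  Rows in \<open>F\<close> are seen by \<open>d\<close> databases, enough to interpolate a polynomial of degree below \<open>d\<close>;
  the others are only seen by the systematic databases \<open>1, \<dots>, k\<close>. As only the values at the
  systematic points matter, it suffices that the mask of a row in \<open>F\<close> is either one common row
  or, at a systematic database, already interpolated.
\<close>

locale retrieval_pattern =
  fixes \<kappa> \<delta> k d :: nat and J F :: "nat set" and \<theta> :: "nat \<Rightarrow> nat \<Rightarrow> nat" and \<alpha> :: "nat \<Rightarrow> 'a::field"
  assumes permutes: "j \<in> J \<Longrightarrow> \<theta> j permutes {..<\<kappa> + \<delta>}"
    and inj: "inj_on \<alpha> J" and J: "finite J" "{1..k} \<subseteq> J"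
    and F: "F \<subseteq> {..<\<kappa> + \<delta>}"
    and full_card: "a \<in> F \<Longrightarrow> d \<le> card {j \<in> J. inv (\<theta> j) a < \<kappa>}"
    and full_side: "a \<in> F \<Longrightarrow> \<zeta> < \<delta> \<Longrightarrow> \<exists>b e. b < \<kappa> + \<delta> \<and> e < \<kappa> \<and>
      (\<forall>j\<in>J. inv (\<theta> j) a < \<kappa> \<longrightarrow>
        \<theta> j (\<kappa> + \<zeta>) = b \<and> inv (\<theta> j) a = e \<or> j \<in> {1..k} \<and> \<theta> j (\<kappa> + \<zeta>) \<in> F)"
    and sys: "a < \<kappa> + \<delta> \<Longrightarrow> a \<notin> F \<Longrightarrow> j \<in> {1..k} \<Longrightarrow> inv (\<theta> j) a < \<kappa>"
    and sys_side: "a < \<kappa> + \<delta> \<Longrightarrow> a \<notin> F \<Longrightarrow> j \<in> {1..k} \<Longrightarrow> \<zeta> < \<delta> \<Longrightarrow> \<theta> j (\<kappa> + \<zeta>) \<in> F"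
begin

lemma zero_on_full_row:
  assumes "a \<in> F" "degree p < d" "\<And>j. j \<in> J \<Longrightarrow> inv (\<theta> j) a < \<kappa> \<Longrightarrow> poly p (\<alpha> j) = 0"
  shows "p = 0"
proof -
  let ?A = "{j \<in> J. inv (\<theta> j) a < \<kappa>}"
  have "card (\<alpha> ` ?A) = card ?A"
    by (intro card_image inj_on_subset[OF inj]) auto
  then show ?thesis
    using full_card[OF assms(1)] assms
    by (intro poly_eqI_degree[of "\<alpha> ` ?A"]) auto
qed

text \<open>\<open>zero\<close> says that all answers vanish. The sums without \<open>v\<close> show
  that the interference vanishes, as a polynomial on the rows in \<open>F\<close> and at the
  systematic points on the others. A sum with \<open>v\<close> then equates \<open>Y v l\<close>
  with interference on a mask row, and the pattern carries this to the systematic points.\<close>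

lemma decode:
  fixes Y :: "nat \<Rightarrow> nat list \<times> nat list \<times> nat set \<Rightarrow> 'a poly"
  assumes v: "v \<in> {1..\<mu>}" and deg: "\<And>i l. i \<in> {1..\<mu>} \<Longrightarrow> l \<in> labels \<kappa> \<delta> \<mu> \<Longrightarrow> degree (Y i l) < d"
    and zero: "\<And>j S P z. j \<in> J \<Longrightarrow> S \<subseteq> {1..\<mu>} \<Longrightarrow> S \<noteq> {} \<Longrightarrow> set P \<subseteq> {..<\<kappa>} \<Longrightarrow> length P = \<mu> + 1 - card S \<Longrightarrow>
      set z \<subseteq> {..<\<delta>} \<Longrightarrow> length z = card S - 1 \<Longrightarrow>
      (\<Sum>i\<in>S. ksign i S * (side_sign v (P, z, S - {i}) *
         poly (Y i (relabel \<kappa> v (\<theta> j) (P, z, S - {i}))) (\<alpha> j))) = 0"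
    and l: "l \<in> labels \<kappa> \<delta> \<mu>" and c: "c \<in> {1..k}"
  shows "poly (Y v l) (\<alpha> c) = 0"
proof -
  \<comment> \<open>The interference over \<open>S\<close> on row number \<open>a\<close>, with
    \<open>p\<close> and \<open>z\<close> the remaining letters.\<close>
  define I where "I S a p z = (\<Sum>i\<in>S. smult (ksign i S) (Y i (mk_label \<kappa> v a p z (S - {i}))))" for S a p z
  define valid where "valid S p z \<longleftrightarrow> S \<noteq> {} \<and> S \<subseteq> {1..\<mu>} - {v} \<and> set p \<subseteq> {..<\<kappa>} \<and> length p = \<mu> - card S \<and>
    set z \<subseteq> {..<\<delta>} \<and> length z = card S - 1" for S p z
  have fin: "finite S" and card: "card S < \<mu>" if "S \<subseteq> {1..\<mu>} - {v}" for S
  proof -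
    show "finite S" using that finite_subset by blast
    have "card S \<le> card ({1..\<mu>} - {v})" using that by (intro card_mono) auto
    then show "card S < \<mu>" using v by auto
  qed
  have perm: "\<theta> j (inv (\<theta> j) a) = a" if "j \<in> J" for j a
    using permutes_inverses[OF permutes[OF that]] by simp
  have dpos: "0 < d" using deg[OF v l] by simp
  have degI: "degree (I S a p z) < d" if "valid S p z" "a < \<kappa> + \<delta>" for S a p z
    unfolding I_def
  proof (rule degree_sum_less)
    fix i assume i: "i \<in> S"
    have S: "S \<subseteq> {1..\<mu>} - {v}" using that by (simp add: valid_def)
    have cS: "card (S - {i}) = card S - 1" "\<mu> - 1 - (card S - 1) = \<mu> - card S"
      using i fin[OF S] card_gt_0_iff[of S] by (auto simp: card_Diff_singleton)
    have "length p = \<mu> - 1 - card (S - {i})" "length z = card (S - {i})"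
      using that by (simp_all only: valid_def cS)
    then have "mk_label \<kappa> v a p z (S - {i}) \<in> labels \<kappa> \<delta> \<mu>"
      using that v by (intro mk_label_in_labels) (auto simp: valid_def)
    then have "degree (Y i (mk_label \<kappa> v a p z (S - {i}))) < d"
      using i S by (intro deg) auto
    then show "degree (smult (ksign i S) (Y i (mk_label \<kappa> v a p z (S - {i})))) < d"
      by simp
  qed (fact dpos)
  \<comment> \<open>\<open>\<theta> j\<close> relabels the letter \<open>inv (\<theta> j) a\<close>
    to row \<open>a\<close>; as it is below \<open>\<kappa>\<close>, database \<open>j\<close>
    returns this row unmasked.\<close>
  have I_zero: "poly (I S a p z) (\<alpha> j) = 0"
    if val: "valid S p z" and j: "j \<in> J" "inv (\<theta> j) a < \<kappa>" for S a p z j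
  proof -
    let ?e = "inv (\<theta> j) a"
    have S: "S \<subseteq> {1..\<mu>} - {v}" using val by (simp add: valid_def)
    have "(\<Sum>i\<in>S. ksign i S * (side_sign v (?e # p, z, S - {i}) *
         poly (Y i (relabel \<kappa> v (\<theta> j) (?e # p, z, S - {i}))) (\<alpha> j))) = 0"
      using val j card[OF S] by (intro zero) (auto simp: valid_def)
    moreover have "v \<notin> S" using S by blast
    ultimately show ?thesis
      using j by (simp add: I_def poly_sum side_sign_def perm)
  qed
  have I_full: "I S a p z = 0" if "valid S p z" "a \<in> F" for S a p z
    using that F by (intro zero_on_full_row[of a] degI I_zero) auto
  have I_sys: "poly (I S a p z) (\<alpha> j) = 0" if "valid S p z" "a < \<kappa> + \<delta>" "j \<in> {1..k}" for S a p z j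
    using that I_full[of S p z a] I_zero[of S p z j a] sys[of a j] J by (cases "a \<in> F") auto
  from l show ?thesis
  proof (rule labels_cases[OF _ v])
    fix a p z T
    assume l_eq: "l = mk_label \<kappa> v a p z T" and T: "T \<subseteq> {1..\<mu>} - {v}" and a: "a < \<kappa> + \<delta>"
      and p: "set p \<subseteq> {..<\<kappa>}" "length p = \<mu> - 1 - card T" and z: "set z \<subseteq> {..<\<delta>}" "length z = card T"
    have vT: "v \<notin> T" using T by blast
    note finT = fin[OF T] and cardT = card[OF T]
    \<comment> \<open>In the sum over \<open>insert v T\<close>, the first letter of
      \<open>z\<close> makes database \<open>j\<close> mask row \<open>a\<close> by row
      \<open>\<theta> j (\<kappa> + hd z)\<close>; by \<open>ksign_swap\<close> the mask has the
      common factor \<open>- ksign v T\<close>.\<close>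
    have key: "poly (Y v l) (\<alpha> j) = poly (I T (\<theta> j (\<kappa> + hd z)) (inv (\<theta> j) a # p) (tl z)) (\<alpha> j)"
      if j: "j \<in> J" "inv (\<theta> j) a < \<kappa>" for j
    proof -
      let ?e = "inv (\<theta> j) a" and ?b = "\<theta> j (\<kappa> + hd z)" and ?S = "insert v T"
      have "(\<Sum>i\<in>?S. ksign i ?S * (side_sign v (?e # p, z, ?S - {i}) *
           poly (Y i (relabel \<kappa> v (\<theta> j) (?e # p, z, ?S - {i}))) (\<alpha> j))) = 0"
        using j p z T v vT finT cardT by (intro zero) auto
      moreover have "ksign i ?S * (side_sign v (?e # p, z, ?S - {i}) *
           poly (Y i (relabel \<kappa> v (\<theta> j) (?e # p, z, ?S - {i}))) (\<alpha> j))
        = - (ksign v T * poly (smult (ksign i T) (Y i (mk_label \<kappa> v ?b (?e # p) (tl z) (T - {i})))) (\<alpha> j))"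
        if "i \<in> T" for i
      proof -
        have "i \<noteq> v" "?S - {i} = insert v (T - {i})" using that vT by auto
        moreover have "T - {i} - {v} = T - {i}" using vT by auto
        moreover have "ksign i ?S * (ksign v (T - {i}) * x) = - (ksign v T * (ksign i T * x))" for x :: 'a
          using ksign_swap[of i v T, where 'a = 'a] that vT \<open>i \<noteq> v\<close> by (simp flip: mult.assoc)
        ultimately show ?thesis by (simp add: side_sign_def)
      qed
      ultimately have "ksign v T * poly (Y v l) (\<alpha> j) - ksign v T * poly (I T ?b (?e # p) (tl z)) (\<alpha> j) = 0"
        using vT finT j
        by (simp add: side_sign_def I_def poly_sum perm l_eq sum_distrib_left sum_negf)
      then show ?thesis by simp
    qed
    show ?thesis
    proof (cases "T = {}")
      case True
      have Yz: "poly (Y v l) (\<alpha> j) = 0" if "j \<in> J" "inv (\<theta> j) a < \<kappa>" for j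
        using key[OF that] True by (simp add: I_def)
      show ?thesis
      proof (cases "a \<in> F")
        case True
        then have "Y v l = 0" using zero_on_full_row deg[OF v l] Yz by blast
        then show ?thesis by simp
      next
        case False
        then show ?thesis using Yz a c sys J by blast
      qed
    next
      case False
      then obtain \<zeta> z' where z': "z = \<zeta> # z'" using z finT by (cases z) auto
      then have \<zeta>: "\<zeta> < \<delta>" using z by simp
      have val: "valid T (e # p) z'" if "e < \<kappa>" for e
        using that False T p z z' cardT by (auto simp: valid_def)
      show ?thesis
      proof (cases "a \<in> F")
        case True
        then obtain b e where b: "b < \<kappa> + \<delta>" "e < \<kappa>"
          and be: "\<And>j. j \<in> J \<Longrightarrow> inv (\<theta> j) a < \<kappa> \<Longrightarrow>
            \<theta> j (\<kappa> + \<zeta>) = b \<and> inv (\<theta> j) a = e \<or> j \<in> {1..k} \<and> \<theta> j (\<kappa> + \<zeta>) \<in> F"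
          using full_side[OF True \<zeta>] by blast
        \<comment> \<open>At every database that sees \<open>a\<close> this difference vanishes: by
          \<open>key\<close> if the mask row is \<open>b\<close>, and otherwise because both terms
          vanish at a systematic point. There are at least \<open>d\<close> such databases.\<close>
        have "Y v l - I T b (e # p) z' = 0"
        proof (rule zero_on_full_row[OF True])
          show "degree (Y v l - I T b (e # p) z') < d"
            using deg[OF v l] degI[OF val[OF b(2)] b(1)] by (intro degree_diff_less)
          fix j assume j: "j \<in> J" "inv (\<theta> j) a < \<kappa>"
          show "poly (Y v l - I T b (e # p) z') (\<alpha> j) = 0"
            using be[OF j]
          proof
            assume "\<theta> j (\<kappa> + \<zeta>) = b \<and> inv (\<theta> j) a = e"
            then show ?thesis using key[OF j] z' by simp
          next
            assume *: "j \<in> {1..k} \<and> \<theta> j (\<kappa> + \<zeta>) \<in> F"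
            then have "poly (Y v l) (\<alpha> j) = 0"
              using key[OF j] z' I_full[OF val[OF j(2)]] by simp
            then show ?thesis using I_sys[OF val[OF b(2)] b(1)] * by simp
          qed
        qed
        then show ?thesis using I_sys[OF val[OF b(2)] b(1) c] by simp
      next
        case F: False
        have j: "c \<in> J" "inv (\<theta> c) a < \<kappa>" using c J sys[OF a F] by auto
        show ?thesis
          using key[OF j] z' I_full[OF val[OF j(2)] sys_side[OF a F c \<zeta>]] by simp
      qed
    qed
  qed
qed

end

section \<open>Candidate polynomials: linear dependencies and values along a row\<close>

lemma eval_mpoly_superset:
  assumes "finite A" "Poly_Mapping.keys p \<subseteq> A"
  shows "eval_mpoly p x = (\<Sum>t\<in>A. Poly_Mapping.lookup p t *
    (\<Prod>m\<in>Poly_Mapping.keys t. x m ^ Poly_Mapping.lookup t m))"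
  unfolding eval_mpoly_def using assms
  by (intro sum.mono_neutral_left) (auto simp: in_keys_iff)

text \<open>Stars and bars: with the slack \<open>g - monom_deg t\<close> added, the exponents sum
  to \<open>g\<close>. The constant monomial is counted as well and accounts for the subtracted
  1.\<close>

lemma card_monoms: "finite (monoms g f)" "card (monoms g f) \<le> num_monoms g f"
proof -
  define h where "h t = map (Poly_Mapping.lookup t) [1..<f + 1] @ [g - monom_deg t]" for t
  let ?A = "insert 0 (monoms g f)" and ?B = "{l :: nat list. length l = f + 1 \<and> sum_list l = g}"
  have keys: "Poly_Mapping.keys t \<subseteq> {1..f}" and deg: "monom_deg t \<le> g" if "t \<in> ?A" for t
    using that by (auto simp: monoms_def monom_deg_def)
  have img: "h ` ?A \<subseteq> ?B"
  proof
    fix l assume "l \<in> h ` ?A"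
    then obtain t where t: "t \<in> ?A" "l = h t" by blast
    have "sum_list (map (Poly_Mapping.lookup t) [1..<f + 1]) = (\<Sum>m\<in>{1..<f + 1}. Poly_Mapping.lookup t m)"
      by (simp only: sum_set_upt_conv_sum_list_nat[symmetric] set_upt)
    also have "\<dots> = monom_deg t"
      unfolding monom_deg_def using keys[OF t(1)]
      by (intro sum.mono_neutral_right) (auto simp: in_keys_iff)
    finally show "l \<in> ?B" using deg[OF t(1)] by (simp add: t(2) h_def)
  qed
  have inj: "inj_on h ?A"
  proof (rule inj_onI)
    fix s t assume s: "s \<in> ?A" and t: "t \<in> ?A" and "h s = h t"
    then have "\<forall>m\<in>{1..f}. Poly_Mapping.lookup s m = Poly_Mapping.lookup t m"
      by (simp add: h_def atLeastLessThanSuc_atLeastAtMost del: upt_Suc)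
    then show "s = t"
      using keys[OF s] keys[OF t] by (intro poly_mapping_eqI) (metis in_keys_iff subsetD)
  qed
  have card: "card ?B = (g + f) choose g"
    using card_length_sum_list[of "f + 1" g] by simp
  then have finB: "finite ?B" by (intro card_ge_0_finite) simp
  have fin: "finite ?A" by (rule inj_on_finite[OF inj img finB])
  then show "finite (monoms g f)" by simp
  have "card ?A \<le> (g + f) choose g"
    using card_inj_on_le[OF inj img finB] card by simp
  moreover have "0 \<notin> monoms g f" by (simp add: monoms_def monom_deg_def)
  ultimately show "card (monoms g f) \<le> num_monoms g f"
    using fin by (simp add: num_monoms_def)
qed

definition mpoly_scale :: "'a::field \<Rightarrow> 'a mpoly \<Rightarrow> 'a mpoly" where
  "mpoly_scale c = Poly_Mapping.map ((*) c)"

lemma lookup_mpoly_scale: "Poly_Mapping.lookup (mpoly_scale c p) t = c * Poly_Mapping.lookup p t"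
  by (simp add: mpoly_scale_def map.rep_eq when_def)

text \<open>A basis chosen among the candidates has at most \<open>num_monoms g f\<close> elements,
  since all candidates are combinations of the monomials in \<open>monoms g f\<close>.\<close>

lemma candidate_spanning_set:
  fixes \<phi> :: "nat \<Rightarrow> 'a::field mpoly"
  assumes "candidate_family g f \<mu> \<phi>"
  obtains P and c :: "nat \<Rightarrow> nat \<Rightarrow> 'a" where "P \<subseteq> {1..\<mu>}" "card P = min \<mu> (num_monoms g f)"
    "\<And>p q. p \<in> P \<Longrightarrow> q \<in> P \<Longrightarrow> c p q = (if p = q then 1 else 0)"
    "\<And>i t. i \<in> {1..\<mu>} \<Longrightarrow> Poly_Mapping.lookup (\<phi> i) t = (\<Sum>p\<in>P. c i p * Poly_Mapping.lookup (\<phi> p) t)"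
proof -
  interpret vector_space "mpoly_scale :: 'a \<Rightarrow> _"
    by unfold_locales (auto intro!: poly_mapping_eqI simp: lookup_mpoly_scale lookup_add algebra_simps)
  let ?V = "\<phi> ` {1..\<mu>}" and ?u = "\<lambda>t. Poly_Mapping.single t (1::'a)"
  obtain B where B: "B \<subseteq> ?V" "independent B" "?V \<subseteq> span B"
    by (rule maximal_independent_subset)
  have V: "?V \<subseteq> span (?u ` monoms g f)"
  proof
    fix p assume "p \<in> ?V"
    then have keys: "Poly_Mapping.keys p \<subseteq> monoms g f"
      using assms by (auto simp: candidate_family_def)
    have "p = (\<Sum>t\<in>Poly_Mapping.keys p. mpoly_scale (Poly_Mapping.lookup p t) (?u t))"
      by (rule poly_mapping_eqI)
        (simp add: lookup_sum lookup_mpoly_scale lookup_single when_def in_keys_iff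
          if_distrib[of "(*) _"] cong: if_cong)
    also have "\<dots> \<in> span (?u ` monoms g f)"
      using keys by (intro span_sum span_scale span_base) auto
    finally show "p \<in> span (?u ` monoms g f)" .
  qed
  have "card B \<le> card (?u ` monoms g f)"
    using independent_span_bound[OF _ B(2), of "?u ` monoms g f"] card_monoms(1) B(1) V by blast
  also have "\<dots> \<le> num_monoms g f"
    using card_image_le[OF card_monoms(1)] card_monoms(2) order_trans by blast
  finally have cardB: "card B \<le> num_monoms g f" .
  have inj: "inj_on \<phi> {1..\<mu>}"
  proof (rule inj_onI)
    fix i j assume ij: "i \<in> {1..\<mu>}" "j \<in> {1..\<mu>}" "\<phi> i = \<phi> j"
    then have "\<exists>c. \<forall>t. Poly_Mapping.lookup (\<phi> i) t = c * Poly_Mapping.lookup (\<phi> j) t"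
      by (intro exI[of _ 1]) simp
    then show "i = j" using assms ij unfolding candidate_family_def by blast
  qed
  define P0 where "P0 = {i \<in> {1..\<mu>}. \<phi> i \<in> B}"
  have P0: "P0 \<subseteq> {1..\<mu>}" "\<phi> ` P0 = B" "inj_on \<phi> P0"
  proof -
    show "P0 \<subseteq> {1..\<mu>}" by (auto simp: P0_def)
    then show "inj_on \<phi> P0" by (rule inj_on_subset[OF inj])
    show "\<phi> ` P0 = B" using B(1) unfolding P0_def by blast
  qed
  then have "card P0 = card B" by (metis card_image)
  moreover have "card P0 \<le> \<mu>" using card_mono[OF _ P0(1)] by simp
  ultimately have "card P0 \<le> min \<mu> (num_monoms g f)" using cardB by simp
  \<comment> \<open>The basis may be smaller than the minimum that enters the rate; arbitrary
    further indices fill it up.\<close>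
  then obtain P where P: "P0 \<subseteq> P" "P \<subseteq> {1..\<mu>}" "card P = min \<mu> (num_monoms g f)"
    using exists_subset_between[of P0 "min \<mu> (num_monoms g f)" "{1..\<mu>}"] P0(1) by auto
  have finP: "finite P" using P finite_subset by blast
  have finB: "finite B" using B(1) finite_subset by blast
  have "\<exists>u. \<phi> i = (\<Sum>b\<in>B. mpoly_scale (u b) b)" if "i \<in> {1..\<mu>}" for i
  proof -
    have "\<phi> i \<in> span B" using B(3) that by blast
    then show ?thesis unfolding span_finite[OF finB] by (rule rangeE) blast
  qed
  then obtain u where u: "\<phi> i = (\<Sum>b\<in>B. mpoly_scale (u i b) b)" if "i \<in> {1..\<mu>}" for i
    by metis
  \<comment> \<open>Indices in \<open>P\<close> represent themselves and the others are expanded in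
    the basis \<open>P0\<close>, so \<open>c\<close> is the identity on \<open>P\<close> even if
    \<open>P\<close> is dependent.\<close>
  define c where "c i p = (if i \<in> P then if i = p then 1 else 0 else if p \<in> P0 then u i (\<phi> p) else 0)" for i p
  show ?thesis
  proof
    show "P \<subseteq> {1..\<mu>}" "card P = min \<mu> (num_monoms g f)" by fact+
    show "c p q = (if p = q then 1 else 0)" if "p \<in> P" "q \<in> P" for p q
      using that by (simp add: c_def)
    show "Poly_Mapping.lookup (\<phi> i) t = (\<Sum>p\<in>P. c i p * Poly_Mapping.lookup (\<phi> p) t)"
      if i: "i \<in> {1..\<mu>}" for i t
    proof (cases "i \<in> P")
      case True
      then show ?thesis using finP by (simp add: c_def if_distrib[of "\<lambda>x. x * _"] cong: if_cong)
    next
      case False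
      have "(\<Sum>p\<in>P. c i p * Poly_Mapping.lookup (\<phi> p) t) = (\<Sum>p\<in>P0. u i (\<phi> p) * Poly_Mapping.lookup (\<phi> p) t)"
        using False P finP by (intro sum.mono_neutral_cong_right) (auto simp: c_def)
      also have "\<dots> = (\<Sum>b\<in>B. u i b * Poly_Mapping.lookup b t)"
        using P0 by (simp add: sum.reindex flip: P0(2))
      also have "\<dots> = Poly_Mapping.lookup (\<phi> i) t"
        by (subst u[OF i]) (simp add: lookup_sum lookup_mpoly_scale)
      finally show ?thesis ..
    qed
  qed
qed

lemma eval_mpoly_lincomb:
  fixes \<phi> :: "nat \<Rightarrow> 'a::field mpoly"
  assumes "finite P" "\<And>t. Poly_Mapping.lookup p t = (\<Sum>q\<in>P. c q * Poly_Mapping.lookup (\<phi> q) t)"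
  shows "eval_mpoly p x = (\<Sum>q\<in>P. c q * eval_mpoly (\<phi> q) x)"
proof -
  define A where "A = Poly_Mapping.keys p \<union> (\<Union>q\<in>P. Poly_Mapping.keys (\<phi> q))"
  have A: "finite A" using assms(1) by (simp add: A_def)
  have "eval_mpoly (\<phi> q) x = (\<Sum>t\<in>A. Poly_Mapping.lookup (\<phi> q) t *
    (\<Prod>m\<in>Poly_Mapping.keys t. x m ^ Poly_Mapping.lookup t m))" if "q \<in> P" for q
    using A that by (intro eval_mpoly_superset) (auto simp: A_def)
  then have "(\<Sum>q\<in>P. c q * eval_mpoly (\<phi> q) x) = (\<Sum>q\<in>P. \<Sum>t\<in>A. c q * (Poly_Mapping.lookup (\<phi> q) t *
    (\<Prod>m\<in>Poly_Mapping.keys t. x m ^ Poly_Mapping.lookup t m)))"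
    by (simp add: sum_distrib_left)
  also have "\<dots> = (\<Sum>t\<in>A. \<Sum>q\<in>P. c q * (Poly_Mapping.lookup (\<phi> q) t *
    (\<Prod>m\<in>Poly_Mapping.keys t. x m ^ Poly_Mapping.lookup t m)))"
    by (rule sum.swap)
  also have "\<dots> = (\<Sum>t\<in>A. Poly_Mapping.lookup p t * (\<Prod>m\<in>Poly_Mapping.keys t. x m ^ Poly_Mapping.lookup t m))"
    by (simp add: assms(2) sum_distrib_right mult.assoc)
  also have "\<dots> = eval_mpoly p x"
    using A by (intro eval_mpoly_superset[symmetric]) (auto simp: A_def)
  finally show ?thesis ..
qed

text \<open>With \<open>L m\<close> interpolating a row of message \<open>m\<close>, the value at
  \<open>\<alpha> j\<close> is what database \<open>j\<close> can compute from its own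
  symbols.\<close>

definition compose_mpoly :: "'a::field mpoly \<Rightarrow> (nat \<Rightarrow> 'a poly) \<Rightarrow> 'a poly" where
  "compose_mpoly p L = (\<Sum>t\<in>Poly_Mapping.keys p. smult (Poly_Mapping.lookup p t)
     (\<Prod>m\<in>Poly_Mapping.keys t. L m ^ Poly_Mapping.lookup t m))"

lemma poly_compose_mpoly: "poly (compose_mpoly p L) a = eval_mpoly p (\<lambda>m. poly (L m) a)"
  by (simp add: compose_mpoly_def eval_mpoly_def poly_sum poly_prod)

lemma degree_compose_mpoly:
  assumes "Poly_Mapping.keys p \<subseteq> monoms g f" "\<And>m. degree (L m) \<le> d"
  shows "degree (compose_mpoly p L) \<le> g * d"
  unfolding compose_mpoly_def
proof (rule degree_sum_le)
  fix t assume t: "t \<in> Poly_Mapping.keys p"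
  have "degree (\<Prod>m\<in>Poly_Mapping.keys t. L m ^ Poly_Mapping.lookup t m)
      \<le> sum (degree \<circ> (\<lambda>m. L m ^ Poly_Mapping.lookup t m)) (Poly_Mapping.keys t)"
    by (rule degree_prod_sum_le) simp
  also have "\<dots> \<le> (\<Sum>m\<in>Poly_Mapping.keys t. Poly_Mapping.lookup t m * d)"
  proof (rule sum_mono)
    fix m
    have "degree (L m ^ Poly_Mapping.lookup t m) \<le> degree (L m) * Poly_Mapping.lookup t m"
      by (rule degree_power_le)
    also have "\<dots> \<le> d * Poly_Mapping.lookup t m" using assms(2) by simp
    finally show "(degree \<circ> (\<lambda>m. L m ^ Poly_Mapping.lookup t m)) m \<le> Poly_Mapping.lookup t m * d"
      by (simp add: mult.commute)
  qed
  also have "\<dots> = monom_deg t * d" by (simp add: monom_deg_def sum_distrib_right)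
  also have "\<dots> \<le> g * d" using t assms(1) by (intro mult_right_mono) (auto simp: monoms_def)
  finally show "degree (smult (Poly_Mapping.lookup p t)
      (\<Prod>m\<in>Poly_Mapping.keys t. L m ^ Poly_Mapping.lookup t m)) \<le> g * d"
    using degree_smult_le order_trans by blast
qed simp

lemma lagrange_poly:
  assumes "inj_on \<alpha> {1..k}" "1 \<le> k"
  shows "degree (lagrange_poly \<alpha> k u) \<le> k - 1" "i \<in> {1..k} \<Longrightarrow> poly (lagrange_poly \<alpha> k u) (\<alpha> i) = u i"
  using theI'[OF lagrange_poly_unique[OF assms, of u]] by (simp_all add: lagrange_poly_def)

text \<open>
  A sum over \<open>S\<close> disjoint from a spanning set \<open>P\<close> of candidates is redundant by
  \<open>alternating_sum_redundant\<close>, and the sums of a single term are functions of \<open>f\<close> code symbols, so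
  neither kind is sent.
\<close>

definition sum_indices :: "nat \<Rightarrow> nat \<Rightarrow> nat \<Rightarrow> nat set \<Rightarrow> (nat list \<times> nat list \<times> nat set) set" where
  "sum_indices \<kappa> \<delta> \<mu> P = word_triples \<kappa> \<delta> (\<lambda>t. \<mu> + 1 - t) (\<lambda>t. t - 1)
     {S \<in> Pow {1..\<mu>}. 2 \<le> card S \<and> S \<inter> P \<noteq> {}}"

lemma remove_in_labels:
  assumes "S \<subseteq> {1..\<mu>}" "i \<in> S" "set P \<subseteq> {..<\<kappa>}" "length P = \<mu> + 1 - card S"
    "set z \<subseteq> {..<\<delta>}" "length z = card S - 1"
  shows "(P, z, S - {i}) \<in> labels \<kappa> \<delta> \<mu>"
proof -
  have "finite S" using assms(1) finite_subset by blast
  then have "0 < card S" "card (S - {i}) = card S - 1"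
    using assms(2) by (auto simp: card_gt_0_iff card_Diff_singleton)
  then show ?thesis using assms by (auto simp: labels_def word_triples_def)
qed

text \<open>There are as many rows as labels, so a key uses every row exactly once, and recovering
  the desired function for all labels recovers it on all rows.\<close>

lemma scheme_achievable:
  fixes \<alpha> :: "nat \<Rightarrow> 'a::{finite, field}" and \<phi> :: "nat \<Rightarrow> 'a mpoly"
  assumes pattern: "retrieval_pattern \<kappa> \<delta> k (g * (k - 1) + 1) J F \<theta> \<alpha>"
    and Jn: "J \<subseteq> {1..n}" and k: "1 \<le> k" and \<kappa>: "1 \<le> \<kappa>"
    and cand: "candidate_family g f \<mu> \<phi>"
    and P: "P \<subseteq> {1..\<mu>}"
    and coeff: "\<And>p q. p \<in> P \<Longrightarrow> q \<in> P \<Longrightarrow> a p q = (if p = q then 1 else 0)"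
    and span: "\<And>i t. i \<in> {1..\<mu>} \<Longrightarrow>
      Poly_Mapping.lookup (\<phi> i) t = (\<Sum>p\<in>P. a i p * Poly_Mapping.lookup (\<phi> p) t)"
    and xy: "0 < x" "0 < y"
    and rate: "x * (card J * (card (sum_indices \<kappa> \<delta> \<mu> P) + \<kappa> ^ \<mu> * f)) \<le> (\<kappa> + \<delta>) ^ \<mu> * k * y"
  shows "ppc_achievable \<alpha> n k f \<mu> \<phi> (real x / real y * H_min f \<mu> \<phi>)"
proof -
  interpret retrieval_pattern \<kappa> \<delta> k "g * (k - 1) + 1" J F \<theta> \<alpha> by fact
  define L where "L = labels \<kappa> \<delta> \<mu>"
  define \<beta> where "\<beta> = (\<kappa> + \<delta>) ^ \<mu>"
  define G where "G = (key_space L \<beta> :: (_ \<Rightarrow> nat \<times> 'a) set)"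
  define U where "U v j = relabel \<kappa> v (\<theta> j)" for v j
  define Q where "Q v j = (if j \<in> J then transform_key L (U v j) (side_sign v) else (\<lambda>R :: _ \<Rightarrow> nat \<times> 'a. R))" for v j
  define words where "words = {p. set p \<subseteq> {..<\<kappa>} \<and> length p = \<mu>}"
  define I where "I j = (if j \<in> J then sum_indices \<kappa> \<delta> \<mu> P <+> words \<times> {1..f} else {})" for j
  \<comment> \<open>\<open>Inl\<close> indexes alternating sums. \<open>Inr\<close> indexes raw code
    symbols: for a singleton \<open>S\<close> the second word is empty and the label is
    \<open>(p, [], {})\<close>.\<close>
  define A where "A = (\<lambda>(j::nat) (R :: nat list \<times> nat list \<times> nat set \<Rightarrow> nat \<times> 'a) (C :: nat \<times> nat \<Rightarrow> 'a) y. case y of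
      Inl (p, z, S) \<Rightarrow> \<Sum>i\<in>S. ksign i S * (snd (R (p, z, S - {i})) * eval_mpoly (\<phi> i) (\<lambda>m. C (fst (R (p, z, S - {i})), m)))
    | Inr (p, m) \<Rightarrow> C (fst (R (p, [], {})), m))"
  have finL: "finite L" and cardL: "card L = \<beta>" by (simp_all add: L_def \<beta>_def finite_labels card_labels)
  have U: "bij_betw (U v j) L L" if "v \<in> {1..\<mu>}" "j \<in> J" for v j
    unfolding U_def L_def using that by (intro relabel_bij permutes) auto
  have injk: "inj_on \<alpha> {1..k}" using inj_on_subset[OF inj] J(2) by blast
  note lagr = lagrange_poly[OF injk k]
  have finS: "finite (sum_indices \<kappa> \<delta> \<mu> P)" by (simp add: sum_indices_def finite_word_triples)
  have words: "finite words" "card words = \<kappa> ^ \<mu>"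
    by (simp_all add: words_def finite_lists_length_eq card_lists_length_eq)
  have keys\<phi>: "Poly_Mapping.keys (\<phi> i) \<subseteq> monoms g f" if "i \<in> {1..\<mu>}" for i
    using cand that by (auto simp: candidate_family_def)
  have finP: "finite P" using P finite_subset by blast
  define lag where "lag w r m = lagrange_poly \<alpha> k (\<lambda>c. w (m, r, c))" for w :: "'a messages" and r m :: nat
  have code: "stored \<alpha> k f \<beta> j w (r, m) = poly (lag w r m) (\<alpha> j)" if "r \<in> {1..\<beta>}" "m \<in> {1..f}" for j w r m
    using that by (simp add: stored_def code_symbol_def lag_def)
  have eval: "eval_mpoly (\<phi> i) (\<lambda>m. stored \<alpha> k f \<beta> j w (r, m)) = poly (compose_mpoly (\<phi> i) (lag w r)) (\<alpha> j)"
    if "i \<in> {1..\<mu>}" "r \<in> {1..\<beta>}" for i j w r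
    unfolding poly_compose_mpoly using that code by (intro eval_mpoly_cong[OF keys\<phi>]) auto
  have fstR: "fst (R l) \<in> {1..\<beta>}" "snd (R l) \<noteq> 0" if "R \<in> G" "l \<in> L" for R l
    using that by (auto simp: G_def key_space_def dest!: PiE_mem)
  have QG: "Q v j ` G \<subseteq> G" if "v \<in> {1..\<mu>}" for v j
    using transform_key_in_key_space[OF U, of v j "side_sign v" \<beta>] that side_sign_nonzero
    by (auto simp: Q_def G_def)
  show ?thesis
  proof (rule ppc_achievableI[where G = G and Q = Q and A = A and I = I and \<beta> = \<beta>])
    show "finite G" "G \<noteq> {}" using finL cardL by (simp_all add: G_def finite_key_space key_space_nonempty)
    show "Q v j ` G \<subseteq> G" if "v \<in> {1..\<mu>}" "j \<in> {1..n}" for v j using QG that(1) .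
    show "inj_on (Q v j) G" if "v \<in> {1..\<mu>}" "j \<in> {1..n}" for v j
      using transform_key_inj[OF U, of v j "side_sign v" \<beta>] that side_sign_nonzero
      by (auto simp: Q_def G_def)
    show "finite (I j)" for j using finS words by (simp add: I_def)
    show "1 \<le> \<beta>" "1 \<le> k" "0 < x" "0 < y" using k \<kappa> xy by (simp_all add: \<beta>_def)
    have "1 \<in> {1..k}" using k by simp
    then have "1 \<in> {1..n}" using Jn J(2) by blast
    then show "1 \<le> n" by simp
    have "(\<Sum>j=1..n. card (I j)) = (\<Sum>j\<in>J. card (sum_indices \<kappa> \<delta> \<mu> P) + \<kappa> ^ \<mu> * f)"
      using Jn J(1) finS words
      by (intro sum.mono_neutral_cong_right) (auto simp: I_def card_Plus card_cartesian_product)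
    then show "x * (\<Sum>j=1..n. card (I j)) \<le> \<beta> * k * y" using rate by (simp add: \<beta>_def)
    fix v R w w' r c
    assume v: "v \<in> {1..\<mu>}" and R: "R \<in> G" and r: "r \<in> {1..\<beta>}" and c: "c \<in> {1..k}"
      and same: "\<And>j x. j \<in> {1..n} \<Longrightarrow> x \<in> I j \<Longrightarrow>
        A j (Q v j R) (stored \<alpha> k f \<beta> j w) x = A j (Q v j R) (stored \<alpha> k f \<beta> j w') x"
    \<comment> \<open>Candidates need not be linear in the messages, but the alternating sums are
      linear in the candidate values. Taking differences for two sets of messages with equal answers
      reduces recovery to \<open>decode\<close>.\<close>
    define \<Delta> where "\<Delta> i r = compose_mpoly (\<phi> i) (lag w r) - compose_mpoly (\<phi> i) (lag w' r)" for i r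
    define Y where "Y i l = smult (snd (R l)) (\<Delta> i (fst (R l)))" for i l
    have van: "poly (Y v l) (\<alpha> c) = 0" if "l \<in> L" for l
    proof (rule decode[OF v _ _ that[unfolded L_def] c])
      fix i l assume "i \<in> {1..\<mu>}"
      then have "degree (\<Delta> i (fst (R l))) \<le> g * (k - 1)"
        unfolding \<Delta>_def lag_def by (intro degree_diff_le degree_compose_mpoly[OF keys\<phi>] lagr(1))
      then show "degree (Y i l) < g * (k - 1) + 1"
        unfolding Y_def using degree_smult_le[of "snd (R l)" "\<Delta> i (fst (R l))"] by linarith
    next
      fix j S p z
      assume j: "j \<in> J" and S: "S \<subseteq> {1..\<mu>}" "S \<noteq> {}"
        and p: "set p \<subseteq> {..<\<kappa>}" "length p = \<mu> + 1 - card S" and z: "set z \<subseteq> {..<\<delta>}" "length z = card S - 1"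
      have jn: "j \<in> {1..n}" using j Jn by blast
      define R' where "R' = Q v j R"
      have R': "R' \<in> G" using QG[OF v] R by (auto simp: R'_def)
      define E where "E i T = snd (R' (p, z, T)) * poly (\<Delta> i (fst (R' (p, z, T)))) (\<alpha> j)" for i T
      have E: "E i (S - {i}) = side_sign v (p, z, S - {i}) * poly (Y i (relabel \<kappa> v (\<theta> j) (p, z, S - {i}))) (\<alpha> j)"
        if "i \<in> S" for i
        using remove_in_labels[OF S(1) that p z] j
        by (simp add: E_def R'_def Q_def transform_key_def L_def U_def Y_def mult.assoc)
      have diff: "poly (\<Delta> i (fst (R' l))) (\<alpha> j) =
          eval_mpoly (\<phi> i) (\<lambda>m. stored \<alpha> k f \<beta> j w (fst (R' l), m)) -
          eval_mpoly (\<phi> i) (\<lambda>m. stored \<alpha> k f \<beta> j w' (fst (R' l), m))"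
        if "i \<in> {1..\<mu>}" "l \<in> L" for i l
        using that fstR[OF R'] by (simp add: eval \<Delta>_def)
      have "(\<Sum>i\<in>S. ksign i S * E i (S - {i})) = 0"
      \<comment> \<open>Row and scalar in \<open>E i T\<close> depend on the label only, so linear
        relations between the candidates carry over to \<open>E\<close>, and the sums that avoid
        \<open>P\<close> follow from those that meet it.\<close>
      proof (rule alternating_sum_redundant[where P = P and V = "{1..\<mu>}" and t = "card S"])
        show "E i T = (\<Sum>p\<in>P. a i p * E p T)" if "i \<in> {1..\<mu>}" for i T
          using eval_mpoly_lincomb[OF finP span[OF that]]
          by (simp add: E_def \<Delta>_def poly_compose_mpoly sum_distrib_left right_diff_distrib sum_subtractf mult_ac)
        fix S' assume S': "S' \<subseteq> {1..\<mu>}" "card S' = card S" "S' \<inter> P \<noteq> {}"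
        have mem: "(p, z, S' - {i}) \<in> L" if "i \<in> S'" for i
          using remove_in_labels[OF S'(1) that] p z S'(2) by (simp add: L_def)
        show "(\<Sum>i\<in>S'. ksign i S' * E i (S' - {i})) = 0"
        proof (cases "2 \<le> card S'")
          case True
          have "(p, z, S') \<in> sum_indices \<kappa> \<delta> \<mu> P"
            using True S' p z by (simp add: sum_indices_def word_triples_def)
          then have "Inl (p, z, S') \<in> I j" using j by (simp add: I_def InlI)
          from same[OF jn this] have "(\<Sum>i\<in>S'. ksign i S' * (snd (R' (p, z, S' - {i})) *
              eval_mpoly (\<phi> i) (\<lambda>m. stored \<alpha> k f \<beta> j w (fst (R' (p, z, S' - {i})), m)))) =
            (\<Sum>i\<in>S'. ksign i S' * (snd (R' (p, z, S' - {i})) *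
              eval_mpoly (\<phi> i) (\<lambda>m. stored \<alpha> k f \<beta> j w' (fst (R' (p, z, S' - {i})), m))))"
            by (simp add: A_def R'_def)
          moreover have "E i (S' - {i}) = snd (R' (p, z, S' - {i})) *
              eval_mpoly (\<phi> i) (\<lambda>m. stored \<alpha> k f \<beta> j w (fst (R' (p, z, S' - {i})), m)) -
              snd (R' (p, z, S' - {i})) *
              eval_mpoly (\<phi> i) (\<lambda>m. stored \<alpha> k f \<beta> j w' (fst (R' (p, z, S' - {i})), m))" if "i \<in> S'" for i
            using S'(1) that by (simp add: E_def diff mem subset_iff right_diff_distrib)
          ultimately show ?thesis
            by (simp add: right_diff_distrib sum_subtractf)
        next
          case False
          have "finite S'" using S'(1) finite_subset by blast
          then have "card S' = 1" using False S'(3) card_gt_0_iff[of S'] by force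
          then obtain i where i: "S' = {i}" by (auto simp: card_1_singleton_iff)
          have pz: "z = []" "p \<in> words" using p z S'(2) i by (simp_all add: words_def)
          have l: "(p, [], {}) \<in> L" using mem[of i] i pz by simp
          have "stored \<alpha> k f \<beta> j w (fst (R' (p, [], {})), m) = stored \<alpha> k f \<beta> j w' (fst (R' (p, [], {})), m)"
            if "m \<in> {1..f}" for m
          proof -
            have "Inr (p, m) \<in> I j" using j pz that by (simp add: I_def InrI)
            from same[OF jn this] show ?thesis by (simp add: A_def R'_def)
          qed
          then have "eval_mpoly (\<phi> i) (\<lambda>m. stored \<alpha> k f \<beta> j w (fst (R' (p, [], {})), m)) =
              eval_mpoly (\<phi> i) (\<lambda>m. stored \<alpha> k f \<beta> j w' (fst (R' (p, [], {})), m))"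
            using S'(1) i by (intro eval_mpoly_cong[OF keys\<phi>]) auto
          then have "E i {} = 0" using S'(1) i pz diff[OF _ l, of i] by (simp add: E_def)
          then show ?thesis by (simp add: i)
        qed
      qed (use P coeff S in auto)
      then show "(\<Sum>i\<in>S. ksign i S * (side_sign v (p, z, S - {i}) *
          poly (Y i (relabel \<kappa> v (\<theta> j) (p, z, S - {i}))) (\<alpha> j))) = 0"
        by (simp add: E)
    qed
    have "(fst \<circ> R) ` L = {1..\<beta>}"
    proof (rule card_subset_eq)
      have "inj_on (fst \<circ> R) L" using R by (simp add: G_def key_space_def)
      moreover have "card {1..\<beta>} = card L" by (simp add: cardL)
      ultimately show "card ((fst \<circ> R) ` L) = card {1..\<beta>}" by (simp only: card_image)
    qed (use fstR[OF R] in auto)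
    then obtain l where l: "l \<in> L" "r = fst (R l)" using r by force
    have "poly (\<Delta> v r) (\<alpha> c) = 0" using van[OF l(1)] fstR(2)[OF R l(1)] l(2) by (simp add: Y_def)
    then show "eval_mpoly (\<phi> v) (\<lambda>m. w (m, r, c)) = eval_mpoly (\<phi> v) (\<lambda>m. w' (m, r, c))"
      using lagr(2)[OF c] by (simp add: \<Delta>_def poly_compose_mpoly lag_def)
  qed
qed

section \<open>Retrieval patterns and their rates\<close>

lemma degree_le_excess:
  fixes k g :: nat
  assumes "1 \<le> k" "1 \<le> g"
  shows "k \<le> g * (k - 1) + 1"
proof -
  have "1 * (k - 1) \<le> g * (k - 1)" using assms by (intro mult_right_mono) auto
  then show ?thesis using assms by linarith
qed

text \<open>The \<open>k\<close> systematic databases see row 0, and each of \<open>s\<close>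
  further groups of \<open>d\<close> databases sees one row among \<open>1, ..., s\<close>. Within a
  group all permutations, hence all masks, coincide; the masks of row 0 are rows in
  \<open>F\<close>.\<close>

lemma disjoint_pattern:
  assumes "1 \<le> k" "1 \<le> d" "1 \<le> s" "inj_on \<alpha> {1..k + s * d}"
  shows "retrieval_pattern 1 s k d {1..k + s * d} {1..s}
    (\<lambda>j. Transposition.transpose 0 (if j \<le> k then 0 else (j - k - 1) div d + 1)) \<alpha>"
proof -
  define h where "h j = (if j \<le> k then 0 else (j - k - 1) div d + 1)" for j
  have h: "h j \<le> s" if "j \<in> {1..k + s * d}" for j
  proof -
    have "j - k - 1 < s * d" if "k < j" using \<open>j \<in> {1..k + s * d}\<close> that by auto
    then show ?thesis by (auto simp: h_def Suc_le_eq less_mult_imp_div_less)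
  qed
  have inv: "inv (Transposition.transpose 0 (h j)) = Transposition.transpose 0 (h j)" for j
    by simp
  have zero: "Transposition.transpose 0 (h j) a < 1 \<longleftrightarrow> a = h j" for j a
    by (auto simp: Transposition.transpose_def split: if_splits)
  have "retrieval_pattern 1 s k d {1..k + s * d} {1..s} (\<lambda>j. Transposition.transpose 0 (h j)) \<alpha>"
  proof
    show "Transposition.transpose 0 (h j) permutes {..<1 + s}" if "j \<in> {1..k + s * d}" for j
      using h[OF that] by (intro permutes_swap_id) auto
    show "d \<le> card {j \<in> {1..k + s * d}. inv (Transposition.transpose 0 (h j)) a < 1}" if "a \<in> {1..s}" for a
    proof -
      define r where "r i = k + 1 + (a - 1) * d + i" for i
      have "r ` {..<d} \<subseteq> {j \<in> {1..k + s * d}. inv (Transposition.transpose 0 (h j)) a < 1}"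
      proof (intro image_subsetI CollectI conjI)
        fix i assume "i \<in> {..<d}"
        then have i: "i < d" by simp
        have "(a - 1 + 1) * d \<le> s * d" using that by (intro mult_right_mono) auto
        then show "r i \<in> {1..k + s * d}" using i by (simp add: r_def)
        have "h (r i) = ((a - 1) * d + i) div d + 1" by (simp add: h_def r_def)
        also have "\<dots> = a" using i that by simp
        finally show "inv (Transposition.transpose 0 (h (r i))) a < 1" unfolding inv zero ..
      qed
      moreover have "card (r ` {..<d}) = d" by (subst card_image) (simp_all add: r_def inj_on_def)
      ultimately show ?thesis using card_mono[of "{j \<in> {1..k + s * d}. inv (Transposition.transpose 0 (h j)) a < 1}" "r ` {..<d}"] by simp
    qed
    show "\<exists>b e. b < 1 + s \<and> e < 1 \<and>
        (\<forall>j\<in>{1..k + s * d}. inv (Transposition.transpose 0 (h j)) a < 1 \<longrightarrow>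
           Transposition.transpose 0 (h j) (1 + \<zeta>) = b \<and> inv (Transposition.transpose 0 (h j)) a = e \<or>
           j \<in> {1..k} \<and> Transposition.transpose 0 (h j) (1 + \<zeta>) \<in> {1..s})"
      if "a \<in> {1..s}" "\<zeta> < s" for a \<zeta>
      using that unfolding inv zero
      by (intro exI[of _ "Transposition.transpose 0 a (1 + \<zeta>)"] exI[of _ 0]) (auto simp: Transposition.transpose_def)
  qed (use assms in \<open>auto simp: h_def Transposition.transpose_def split: if_splits\<close>)
  then show ?thesis by (simp add: h_def)
qed

text \<open>
  Used when \<open>d < n < d + k\<close> with \<open>e = n - d\<close>: the systematic database \<open>j\<close> exchanges the \<open>e\<close> cyclically
  consecutive rows \<open>j, \<dots>, j + e - 1\<close> modulo \<open>k\<close> with the rows \<open>k, \<dots>, k + e - 1\<close>, so that each row below \<open>k\<close>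
  is missed by at most \<open>e\<close> databases.
\<close>

definition window_swap :: "nat \<Rightarrow> nat \<Rightarrow> nat \<Rightarrow> nat \<Rightarrow> nat" where
  "window_swap k e j x =
     (if x < k then if (x + k - j) mod k < e then k + (x + k - j) mod k else x
      else if x < k + e then (j + (x - k)) mod k else x)"

lemma window_swap_involution:
  assumes "e < k" "j \<le> k"
  shows "window_swap k e j (window_swap k e j x) = x"
proof -
  consider "x < k" "(x + k - j) mod k < e" | "x < k" "\<not> (x + k - j) mod k < e" | "k \<le> x" "x < k + e" | "k + e \<le> x"
    by linarith
  then show ?thesis
  proof cases
    case 1
    have "(j + (x + k - j) mod k) mod k = (j + (x + k - j)) mod k" by (rule mod_add_right_eq)
    also have "\<dots> = x" using 1 assms by simp
    finally show ?thesis using 1 by (simp add: window_swap_def)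
  next
    case 3
    define y where "y = (j + (x - k)) mod k"
    have y: "y < k" using assms by (simp add: y_def)
    have "(y + (k - j)) mod k = (j + (x - k) + (k - j)) mod k" unfolding y_def by (rule mod_add_left_eq)
    also have "j + (x - k) + (k - j) = x - k + k" using assms by simp
    also have "(x - k + k) mod k = (x - k) mod k" by (rule mod_add_self2)
    also have "\<dots> = x - k" using 3 assms by simp
    finally have "(y + k - j) mod k = x - k" using assms by simp
    moreover have "window_swap k e j x = y" using 3 by (simp add: window_swap_def y_def)
    ultimately show ?thesis using 3 y by (simp add: window_swap_def)
  qed (use assms in \<open>simp_all add: window_swap_def\<close>)
qed

text \<open>The systematic databases see all rows from \<open>k\<close> on and take their masks from
  rows below \<open>k\<close>, that is, from \<open>F\<close>. The other databases use the identity
  and share the mask row \<open>k + \<zeta>\<close>. A row below \<open>k\<close> is missed by at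
  most \<open>e\<close> of the \<open>d + e\<close> databases.\<close>

lemma window_pattern:
  assumes "0 < e" "e < k" "k \<le> d" "inj_on \<alpha> {1..d + e}"
  shows "retrieval_pattern k e k d {1..d + e} {..<k} (\<lambda>j. if j \<le> k then window_swap k e j else id) \<alpha>"
proof -
  define \<theta> where "\<theta> j = (if j \<le> k then window_swap k e j else id)" for j
  have invol: "\<theta> j (\<theta> j x) = x" for j x
    using assms by (simp add: \<theta>_def window_swap_involution)
  then have inv: "inv (\<theta> j) = \<theta> j" for j
    by (intro inv_equality) auto
  have "retrieval_pattern k e k d {1..d + e} {..<k} \<theta> \<alpha>"
  proof (unfold_locales, unfold inv)
    show "\<theta> j permutes {..<k + e}" for j
      unfolding permutes_def
    proof (intro conjI allI impI)
      show "\<theta> j x = x" if "x \<notin> {..<k + e}" for x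
        using that by (simp add: \<theta>_def window_swap_def)
      show "\<exists>!x. \<theta> j x = y" for y
        by (rule ex1I[of _ "\<theta> j y"]) (use invol in auto)
    qed
    show "d \<le> card {j \<in> {1..d + e}. \<theta> j a < k}" if "a \<in> {..<k}" for a
    proof -
      \<comment> \<open>As \<open>j\<close> runs through all residues modulo \<open>k\<close>, the
        window positions are distinct, so at most \<open>e\<close> of them are below
        \<open>e\<close>.\<close>
      let ?B = "{j \<in> {1..k}. (a + k - j) mod k < e}"
      have "inj_on (\<lambda>j. (a + k - j) mod k) {1..k}"
      proof (rule linorder_inj_onI)
        fix i j assume ij: "i < j" "i \<in> {1..k}" "j \<in> {1..k}"
        have "(a + k - i) - (a + k - j) = j - i" using ij by auto
        moreover have "\<not> k dvd j - i" using ij by (auto dest: dvd_imp_le)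
        ultimately show "(a + k - i) mod k \<noteq> (a + k - j) mod k"
          using ij by (subst mod_eq_dvd_iff_nat) auto
      qed auto
      then have "card ?B \<le> card {..<e}"
        by (intro card_inj_on_le[of "\<lambda>j. (a + k - j) mod k"]) (auto intro: inj_on_subset)
      moreover have "{1..d + e} - ?B \<subseteq> {j \<in> {1..d + e}. \<theta> j a < k}"
        using that by (auto simp: \<theta>_def window_swap_def)
      then have "card ({1..d + e} - ?B) \<le> card {j \<in> {1..d + e}. \<theta> j a < k}"
        by (intro card_mono) auto
      moreover have "card ({1..d + e} - ?B) = d + e - card ?B"
        using assms by (subst card_Diff_subset) auto
      ultimately show ?thesis by simp
    qed
    show "\<exists>b u. b < k + e \<and> u < k \<and>
        (\<forall>j\<in>{1..d + e}. \<theta> j a < k \<longrightarrow>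
           \<theta> j (k + \<zeta>) = b \<and> \<theta> j a = u \<or> j \<in> {1..k} \<and> \<theta> j (k + \<zeta>) \<in> {..<k})"
      if "a \<in> {..<k}" "\<zeta> < e" for a \<zeta>
      using that
      by (intro exI[of _ "k + \<zeta>"] exI[of _ a]) (auto simp: \<theta>_def window_swap_def)
  qed (use assms in \<open>auto simp: \<theta>_def window_swap_def\<close>)
  then show ?thesis by (simp add: \<theta>_def[abs_def])
qed

text \<open>The sets \<open>S\<close> are split into those avoiding \<open>P\<close>, the singletons
  in \<open>P\<close> and those whose sums are sent. Multiplied by \<open>\<kappa>\<close>, the
  number of labels with set \<open>S\<close> becomes \<open>\<delta>\<close> times the number of
  sums over \<open>S\<close>, whose words have one more and one fewer letter.\<close>

lemma card_sum_indices:
  assumes "P \<subseteq> {1..\<mu>}"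
  shows "\<delta> * (card (sum_indices \<kappa> \<delta> \<mu> P) + card P * \<kappa> ^ \<mu>) + \<kappa> ^ (card P + 1) * (\<kappa> + \<delta>) ^ (\<mu> - card P)
    = \<kappa> * (\<kappa> + \<delta>) ^ \<mu>"
proof -
  define w where "w S = \<kappa> ^ (\<mu> - card S) * \<delta> ^ card S" for S :: "nat set"
  let ?S2 = "{S \<in> Pow {1..\<mu>}. 2 \<le> card S \<and> S \<inter> P \<noteq> {}}" and ?S1 = "(\<lambda>p. {p}) ` P" and ?S0 = "Pow ({1..\<mu>} - P)"
  have fin: "finite P" using assms finite_subset by blast
  have cP: "card P \<le> \<mu>" using card_mono[OF _ assms] by simp
  have Pow: "Pow {1..\<mu>} = ?S0 \<union> (?S1 \<union> ?S2)"
  proof (intro equalityI subsetI)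
    fix S assume S: "S \<in> Pow {1..\<mu>}"
    then have fS: "finite S" using finite_subset by blast
    show "S \<in> ?S0 \<union> (?S1 \<union> ?S2)"
    proof (cases "S \<inter> P = {}")
      case False
      then have "card S \<noteq> 0" using fS by auto
      then consider "card S = 1" | "2 \<le> card S" by linarith
      then show ?thesis using S False by cases (auto simp: card_1_singleton_iff)
    qed (use S in auto)
  qed (use assms in auto)
  have "(\<kappa> + \<delta>) ^ \<mu> = sum w (Pow {1..\<mu>})"
    using sum_Pow_power[of "{1..\<mu>}" \<kappa> \<delta>] by (simp add: w_def)
  also have "\<dots> = sum w ?S0 + (sum w ?S1 + sum w ?S2)"
  proof -
    have "?S1 \<inter> ?S2 = {}" "?S0 \<inter> (?S1 \<union> ?S2) = {}" by auto
    then show ?thesis using fin by (subst Pow) (simp add: sum.union_disjoint)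
  qed
  finally have total: "\<kappa> * (\<kappa> + \<delta>) ^ \<mu> = \<kappa> * sum w ?S0 + (\<kappa> * sum w ?S1 + \<kappa> * sum w ?S2)"
    by (simp add: algebra_simps)
  have "sum w ?S0 = (\<Sum>S\<in>?S0. \<kappa> ^ card P * (\<kappa> ^ (card ({1..\<mu>} - P) - card S) * \<delta> ^ card S))"
  proof (rule sum.cong[OF refl])
    fix S assume "S \<in> ?S0"
    then have "card S \<le> card ({1..\<mu>} - P)" by (intro card_mono) auto
    then have "\<mu> - card S = card P + (card ({1..\<mu>} - P) - card S)"
      using fin assms cP by (simp add: card_Diff_subset)
    then show "w S = \<kappa> ^ card P * (\<kappa> ^ (card ({1..\<mu>} - P) - card S) * \<delta> ^ card S)"
      by (simp add: w_def power_add)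
  qed
  also have "\<dots> = \<kappa> ^ card P * (\<kappa> + \<delta>) ^ (\<mu> - card P)"
    using sum_Pow_power[of "{1..\<mu>} - P" \<kappa> \<delta>] fin assms
    by (simp add: card_Diff_subset flip: sum_distrib_left)
  finally have S0: "\<kappa> * sum w ?S0 = \<kappa> ^ (card P + 1) * (\<kappa> + \<delta>) ^ (\<mu> - card P)" by simp
  have move: "\<kappa> * w S = \<delta> * (\<kappa> ^ (\<mu> + 1 - card S) * \<delta> ^ (card S - 1))" if "1 \<le> card S" "card S \<le> \<mu>" for S
    using that by (simp add: w_def Suc_diff_le flip: power_Suc mult.assoc)
  have cS: "card S \<le> \<mu>" if "S \<subseteq> {1..\<mu>}" for S using card_mono[OF _ that] by simp
  have "\<kappa> * sum w ?S2 = (\<Sum>S\<in>?S2. \<delta> * (\<kappa> ^ (\<mu> + 1 - card S) * \<delta> ^ (card S - 1)))"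
    unfolding sum_distrib_left using cS by (intro sum.cong move) auto
  also have "\<dots> = \<delta> * card (sum_indices \<kappa> \<delta> \<mu> P)"
    by (simp add: sum_indices_def card_word_triples sum_distrib_left)
  finally have S2: "\<kappa> * sum w ?S2 = \<delta> * card (sum_indices \<kappa> \<delta> \<mu> P)" .
  have "\<kappa> * sum w ?S1 = (\<Sum>p\<in>P. \<kappa> * w {p})"
    by (simp add: sum.reindex sum_distrib_left)
  also have "\<dots> = (\<Sum>p\<in>P. \<delta> * \<kappa> ^ \<mu>)"
    using assms by (intro sum.cong refl) (subst move, auto)
  finally have S1: "\<kappa> * sum w ?S1 = \<delta> * (card P * \<kappa> ^ \<mu>)" by simp
  show ?thesis unfolding total S0 S1 S2 by (simp add: algebra_simps)
qed

lemma pattern_rate: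
  fixes \<alpha> :: "nat \<Rightarrow> 'a::{finite, field}" and \<phi> :: "nat \<Rightarrow> 'a mpoly"
  assumes pattern: "retrieval_pattern \<kappa> \<delta> k (g * (k - 1) + 1) J F \<theta> \<alpha>"
    and J: "J \<subseteq> {1..n}" and k: "1 \<le> k" and \<kappa>: "1 \<le> \<kappa>" and \<delta>: "1 \<le> \<delta>"
    and f: "1 \<le> f" "f \<le> \<mu>" and cand: "candidate_family g f \<mu> \<phi>"
    and M: "M = min \<mu> (num_monoms g f)" and \<rho>: "\<rho> = real \<kappa> / (real \<kappa> + real \<delta>)"
  shows "ppc_achievable \<alpha> n k f \<mu> \<phi> (real k / real (card J) * (1 / \<rho> - 1) * H_min f \<mu> \<phi> /
    (1 - \<rho> ^ M - (real M - real f) * (1 - \<rho>) * \<rho> ^ (\<mu> - 1)))"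
proof -
  obtain P a where P: "P \<subseteq> {1..\<mu>}" "card P = min \<mu> (num_monoms g f)"
    and a: "\<And>p q. p \<in> P \<Longrightarrow> q \<in> P \<Longrightarrow> a p q = (if p = q then 1 else 0)"
      "\<And>i t. i \<in> {1..\<mu>} \<Longrightarrow> Poly_Mapping.lookup (\<phi> i) t = (\<Sum>p\<in>P. a i p * Poly_Mapping.lookup (\<phi> p) t)"
    by (rule candidate_spanning_set[OF cand]) (rule that)
  note P = P[folded M]
  define N where "N = card (sum_indices \<kappa> \<delta> \<mu> P)"
  define x where "x = (\<kappa> + \<delta>) ^ \<mu> * k"
  define y where "y = card J * (N + \<kappa> ^ \<mu> * f)"
  have "{1..k} \<subseteq> J" "finite J" using pattern by (auto simp: retrieval_pattern_def)
  then have cJ: "0 < card J" using k by (auto simp: card_gt_0_iff)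
  have xy: "0 < x" "0 < y" using \<kappa> k f cJ by (auto simp: x_def y_def)
  have "ppc_achievable \<alpha> n k f \<mu> \<phi> (real x / real y * H_min f \<mu> \<phi>)"
    by (rule scheme_achievable[OF pattern J k \<kappa> cand P(1) a xy])
      (simp_all add: x_def y_def N_def mult.assoc)
  moreover have "real x / real y * H_min f \<mu> \<phi> = real k / real (card J) * (1 / \<rho> - 1) * H_min f \<mu> \<phi> /
    (1 - \<rho> ^ M - (real M - real f) * (1 - \<rho>) * \<rho> ^ (\<mu> - 1))"
  proof -
    define \<nu> where "\<nu> = real \<kappa> + real \<delta>"
    define den where "den = 1 - \<rho> ^ M - (real M - real f) * (1 - \<rho>) * \<rho> ^ (\<mu> - 1)"
    have pos: "0 < real \<kappa>" "0 < real \<delta>" "0 < \<nu>" using \<kappa> \<delta> by (auto simp: \<nu>_def)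
    have M\<mu>: "M \<le> \<mu>" by (simp add: M)
    have \<rho>': "\<rho> = real \<kappa> / \<nu>" "1 - \<rho> = real \<delta> / \<nu>" "1 / \<rho> - 1 = real \<delta> / real \<kappa>"
      using pos by (simp_all add: \<rho> \<nu>_def field_simps)
    have \<nu>M: "\<nu> ^ \<mu> = \<nu> ^ M * \<nu> ^ (\<mu> - M)" using M\<mu> by (simp flip: power_add)
    have \<mu>1: "\<nu> ^ \<mu> = \<nu> * \<nu> ^ (\<mu> - 1)" "real \<kappa> ^ \<mu> = real \<kappa> * real \<kappa> ^ (\<mu> - 1)"
      using f by (simp_all flip: power_Suc)
    have "real (\<delta> * (N + M * \<kappa> ^ \<mu>) + \<kappa> ^ (M + 1) * (\<kappa> + \<delta>) ^ (\<mu> - M)) = real (\<kappa> * (\<kappa> + \<delta>) ^ \<mu>)"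
      using card_sum_indices[OF P(1), of \<delta> \<kappa>] by (simp only: N_def P(2))
    then have "real \<delta> * (real N + real M * real \<kappa> ^ \<mu>) + real \<kappa> * real \<kappa> ^ M * \<nu> ^ (\<mu> - M) = real \<kappa> * \<nu> ^ \<mu>"
      by (simp add: \<nu>_def)
    \<comment> \<open>For each word, \<open>M\<close> singleton sums are replaced by
      \<open>f\<close> code symbols; this gives the correction term with
      \<open>M - f\<close>.\<close>
    then have D1: "real \<delta> * (real N + real \<kappa> ^ \<mu> * real f)
        = real \<kappa> * (\<nu> ^ \<mu> - real \<kappa> ^ M * \<nu> ^ (\<mu> - M) - (real M - real f) * real \<delta> * real \<kappa> ^ (\<mu> - 1))"
      unfolding \<mu>1(2) by (simp add: algebra_simps)
    have "\<nu> ^ \<mu> * \<rho> ^ M = real \<kappa> ^ M * \<nu> ^ (\<mu> - M)"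
      unfolding \<nu>M \<rho>'(1) using pos by (simp add: power_divide)
    moreover have "\<nu> ^ \<mu> * ((1 - \<rho>) * \<rho> ^ (\<mu> - 1)) = real \<delta> * real \<kappa> ^ (\<mu> - 1)"
      unfolding \<mu>1(1) \<rho>'(2) using pos by (simp add: \<rho>'(1) power_divide)
    moreover have "\<nu> ^ \<mu> * den
        = \<nu> ^ \<mu> - \<nu> ^ \<mu> * \<rho> ^ M - (real M - real f) * (\<nu> ^ \<mu> * ((1 - \<rho>) * \<rho> ^ (\<mu> - 1)))"
      by (simp add: den_def algebra_simps)
    ultimately have "\<nu> ^ \<mu> * den = \<nu> ^ \<mu> - real \<kappa> ^ M * \<nu> ^ (\<mu> - M) - (real M - real f) * (real \<delta> * real \<kappa> ^ (\<mu> - 1))"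
      by simp
    with D1 have key: "real \<delta> * (real N + real \<kappa> ^ \<mu> * real f) = real \<kappa> * (\<nu> ^ \<mu> * den)"
      by (simp add: mult.assoc)
    have D1pos: "0 < real N + real \<kappa> ^ \<mu> * real f" using pos f by (intro add_nonneg_pos) auto
    \<comment> \<open>The download is positive, so the denominator of the rate is nonzero.\<close>
    then have "0 < real \<kappa> * (\<nu> ^ \<mu> * den)" using pos by (simp flip: key)
    then have "den \<noteq> 0" by auto
    then have "real x / real y = real k / real (card J) * (1 / \<rho> - 1) / den"
      unfolding \<rho>'(3) using key pos cJ D1pos
      by (simp add: x_def y_def divide_simps flip: \<nu>_def)
    then show ?thesis by (simp add: den_def)
  qed
  ultimately show ?thesis by simp
qed

text \<open>The first \<open>k\<close> code symbols are the message symbols, and a constant query is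
  private.\<close>

lemma download_all_achievable:
  fixes \<alpha> :: "nat \<Rightarrow> 'a::{finite, field}" and \<phi> :: "nat \<Rightarrow> 'a mpoly"
  assumes "1 \<le> k" "k \<le> n" "inj_on \<alpha> {1..n}" "1 \<le> f" and cand: "candidate_family g f \<mu> \<phi>"
  shows "ppc_achievable \<alpha> n k f \<mu> \<phi> (1 / real f * H_min f \<mu> \<phi>)"
proof -
  have injk: "inj_on \<alpha> {1..k}" using assms by (auto intro: inj_on_subset)
  have code: "stored \<alpha> k f 1 c w (1, m) = w (m, 1, c)" if "c \<in> {1..k}" "m \<in> {1..f}" for c m and w :: "'a messages"
    using that lagrange_poly(2)[OF injk assms(1) that(1)] by (simp add: stored_def code_symbol_def)
  have "ppc_achievable \<alpha> n k f \<mu> \<phi> (real 1 / real f * H_min f \<mu> \<phi>)"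
  proof (rule ppc_achievableI[where G = "{()}" and Q = "\<lambda>_ _ s. s" and \<beta> = 1
        and I = "\<lambda>j. if j \<in> {1..k} then {1..f} else {}" and A = "\<lambda>_ _ C m. C (1, m)"])
    have "(\<Sum>j=1..n. card (if j \<in> {1..k} then {1..f} else {})) = (\<Sum>j=1..k. f)"
      using assms by (intro sum.mono_neutral_cong_right) auto
    then show "1 * (\<Sum>j=1..n. card (if j \<in> {1..k} then {1..f} else {})) \<le> 1 * k * f" by simp
    fix v :: nat and w w' :: "'a messages" and r c :: nat
    assume v: "v \<in> {1..\<mu>}" and r: "r \<in> {1..1}" and c: "c \<in> {1..k}"
      and same: "\<And>j x. j \<in> {1..n} \<Longrightarrow> x \<in> (if j \<in> {1..k} then {1..f} else {}) \<Longrightarrow>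
        stored \<alpha> k f 1 j w (1, x) = stored \<alpha> k f 1 j w' (1, x)"
    have "w (m, 1, c) = w' (m, 1, c)" if "m \<in> {1..f}" for m
      using same[of c m] code[OF c that] c that assms(2) by simp
    then show "eval_mpoly (\<phi> v) (\<lambda>m. w (m, r, c)) = eval_mpoly (\<phi> v) (\<lambda>m. w' (m, r, c))"
      using r cand v by (intro eval_mpoly_cong[of _ g f]) (auto simp: candidate_family_def)
  qed (use assms in auto)
  then show ?thesis by simp
qed

theorem theorem6:
  fixes \<alpha> :: "nat \<Rightarrow> 'a::{finite, field}"
    and \<phi> :: "nat \<Rightarrow> 'a mpoly"
    and n k f g \<mu> \<kappa> \<nu> :: nat
  assumes "1 \<le> k" and "k \<le> n" and "n \<le> CARD('a)"
    and "inj_on \<alpha> {1..n}"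
    and "1 \<le> f" and "1 \<le> g"
    and "f \<le> \<mu>" and "\<mu> \<le> num_candidates CARD('a) g f"
    and "candidate_family g f \<mu> \<phi>"
    and "real \<kappa> / real \<nu> =
           real k / (real (n_hat g k n) -
             real (n_hat g k n div k_tilde g k n) * (real (k_tilde g k n) - real k))"
  shows "ppc_achievable \<alpha> n k f \<mu> \<phi>
    (if n \<le> g * (k - 1) + 1 then 1 / real f * H_min f \<mu> \<phi>
     else
       (real k / real (n_hat g k n)) * ((real \<nu> - real \<kappa>) / real \<kappa>) * H_min f \<mu> \<phi> /
       (1 - (real \<kappa> / real \<nu>) ^ min \<mu> (num_monoms g f)
          - (real (min \<mu> (num_monoms g f)) - real f) * (1 - real \<kappa> / real \<nu>) * (real \<kappa> / real \<nu>) ^ (\<mu> - 1)))"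
proof (cases "n \<le> g * (k - 1) + 1")
  case True
  then show ?thesis using download_all_achievable assms by simp
next
  case False
  define d where "d = g * (k - 1) + 1"
  have kd: "k \<le> d" "1 \<le> d" using degree_le_excess[OF assms(1,6)] by (simp_all add: d_def)
  have n: "d < n" using False by (simp add: d_def)
  have kt: "k_tilde g k n = d" using n by (simp add: k_tilde_def d_def)
  define nh where "nh = n_hat g k n"
  define q where "q = n div d"
  have q: "1 \<le> q" "q * d \<le> n" using n kd by (simp_all add: q_def Suc_le_eq div_greater_zero_iff)
  \<comment> \<open>The first case of \<open>n_hat\<close> uses the window pattern, the other two
    the disjoint pattern with \<open>s\<close> groups.\<close>
  obtain \<kappa>' \<delta>' F \<theta> where pattern: "retrieval_pattern \<kappa>' \<delta>' k d {1..nh} F \<theta> \<alpha>"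
    and pos: "1 \<le> \<kappa>'" "1 \<le> \<delta>'" and nh: "nh \<le> n"
    and ratio: "real k / (real nh - real (nh div d) * (real d - real k)) = real \<kappa>' / (real \<kappa>' + real \<delta>')"
  proof (cases "q = 1 \<and> n - q * d < k")
    case True
    then have "q = 1" "n - d < k" by auto
    then have nh: "nh = n" "nh = d + (n - d)" using n by (simp_all add: nh_def n_hat_def kt q_def Let_def)
    have "nh div d = 1" using True by (simp add: nh(1) q_def)
    moreover have "0 < n - d" "n - d < k" using True n by auto
    then have "retrieval_pattern k (n - d) k d {1..nh} {..<k} (\<lambda>j. if j \<le> k then window_swap k (n - d) j else id) \<alpha>"
      unfolding nh(2) using kd assms(4) n by (intro window_pattern) simp_all
    ultimately show ?thesis
      using n assms(1) by (intro that[of k "n - d"]) (auto simp: nh(1) of_nat_diff)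
  next
    case False
    define s where "s = (if n - q * d < k then q - 1 else q)"
    have "nh = (if q = 1 \<and> n - q * d < k then n
        else if 1 < q \<and> n - q * d < k then k + (q - 1) * d else k + q * d)"
      by (simp only: nh_def n_hat_def kt q_def Let_def)
    then have "nh = (if 1 < q \<and> n - q * d < k then k + (q - 1) * d else k + q * d)"
      unfolding if_not_P[OF False] .
    then have s: "nh = k + s * d" "1 \<le> s"
      using False q(1) unfolding s_def by (cases "n - q * d < k"; force)+
    have nhn: "nh \<le> n"
    proof (cases "n - q * d < k")
      case True
      then have "q = s + 1" using q by (simp add: s_def)
      then show ?thesis using q(2) s(1) kd by simp
    next
      case False
      then show ?thesis using q s(1) by (simp add: s_def)
    qed
    have pat: "retrieval_pattern 1 s k d {1..nh} {1..s}
        (\<lambda>j. Transposition.transpose 0 (if j \<le> k then 0 else (j - k - 1) div d + 1)) \<alpha>"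
      unfolding s(1) using assms(1) kd s nhn inj_on_subset[OF assms(4)]
      by (intro disjoint_pattern) auto
    \<comment> \<open>For \<open>k = d\<close> the quotient is \<open>s + 1\<close> instead of
      \<open>s\<close>, but the factor \<open>d - k\<close> is zero.\<close>
    have "real (nh div d) * (real d - real k) = real s * (real d - real k)"
    proof (cases "k = d")
      case False
      then have "nh div d = s" using kd by (simp add: s(1))
      then show ?thesis by simp
    qed simp
    then have "real k / (real nh - real (nh div d) * (real d - real k)) = real k / (real k * (1 + real s))"
      by (simp add: s(1) algebra_simps)
    then show ?thesis using that[OF pat _ s(2) nhn] assms(1) by simp
  qed
  define \<rho> where "\<rho> = real \<kappa> / real \<nu>"
  have \<rho>: "\<rho> = real \<kappa>' / (real \<kappa>' + real \<delta>')"
    using assms(10) ratio by (simp add: \<rho>_def kt nh_def)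
  \<comment> \<open>\<open>\<kappa>\<close> and \<open>\<nu>\<close> may be any pair with the given
    quotient; the rate depends on \<open>\<rho>\<close> alone.\<close>
  then have "0 < \<rho>" using pos by simp
  then have "\<kappa> \<noteq> 0" by (intro notI) (simp add: \<rho>_def)
  then have "(real \<nu> - real \<kappa>) / real \<kappa> = 1 / \<rho> - 1"
    by (simp add: \<rho>_def diff_divide_distrib)
  moreover have "ppc_achievable \<alpha> n k f \<mu> \<phi> (real k / real (card {1..nh}) * (1 / \<rho> - 1) * H_min f \<mu> \<phi> /
    (1 - \<rho> ^ min \<mu> (num_monoms g f) - (real (min \<mu> (num_monoms g f)) - real f) * (1 - \<rho>) * \<rho> ^ (\<mu> - 1)))"
    using nh assms pos \<rho> by (intro pattern_rate[OF pattern[unfolded d_def]]) auto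
  ultimately show ?thesis using False by (simp add: nh_def \<rho>_def)
qed

end
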